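(* Let $\Gamma=\langle \gamma_1,\ldots,\gamma_n \mid r_l,\ l\in L\rangle$ be a finitely generated group, where the index set $L$ of relators may be infinite, and let $\pi\colon \mathbb F_n\to\Gamma$ be the natural surjection from the free group on $\gamma_1,\dots,\gamma_n$. Then the homomorphism $B(\mathbb F_n)\to B(\Gamma)$ induced by $\pi$ is surjective and induces an isomorphism of $\mathbb C$-algebras $$B(\Gamma)\cong B(\mathbb F_n)\big/\big(t_{r_l}-2,\ t_{\gamma_i r_l}-t_{\gamma_i},\ t_{\gamma_j\gamma_k r_l}-t_{\gamma_j\gamma_k}\ \big|\ l\in L,\ 1\le i\le n,\ 1\le j<k\le n\big).$$
   Context: For a finitely generated group $\Gamma$ with generators $\gamma_1,\dots,\gamma_n$, the universal $\mathrm{SL}_2(\mathbb C)$-representation algebra $A(\Gamma)$ is the quotient of the polynomial ring $\mathbb C[x^{(k)}_{ij}]$ ($1\le i,j\le 2$, $1\le k\le n$) by the ideal generated by $\det X^{(k)}-1$ ($X^{(k)}=(x^{(k)}_{ij})$) and by the entries of $r(X^{(1)},\dots,X^{(n)})-I$ for all relators $r$. The group $\mathrm{SL}_2(\mathbb C)$ acts on $A(\Gamma)$ by simultaneous conjugation, and $B(\Gamma)=A(\Gamma)^{\mathrm{SL}_2(\mathbb C)}$ is the universal algebra of $\mathrm{SL}_2(\mathbb C)$-characters (coordinate ring of the character scheme $X(\Gamma,\mathrm{SL}_2(\mathbb C))=(\mathrm{Spm}\,B(\Gamma),B(\Gamma))$, which may be non-reduced). For $\gamma\in\Gamma$ represented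 by a word $w_\gamma$, the trace function $t_\gamma\in B(\Gamma)$ is the class of $\operatorname{tr}\big(w_\gamma(X^{(1)},\dots,X^{(n)})\big)$. For $\mathbb F_n$ there are no relators, and $t_w\in B(\mathbb F_n)$ for any word $w$. *)

theory Defs
  imports Complex_Main "HOL-Library.Poly_Mapping"
begin

text \<open>Variables x^(k)_ij are encoded as triples (k,i,j) with k < n and i,j in {0,1}
  (0-based indices). Polynomials over C in these variables are finitely supported maps
  from monomials (finitely supported exponent maps) to coefficients.\<close>

type_synonym var = "nat \<times> nat \<times> nat"
type_synonym mpoly = "(var \<Rightarrow>\<^sub>0 nat) \<Rightarrow>\<^sub>0 complex"

definition Var :: "var \<Rightarrow> mpoly" where
  "Var v = Poly_Mapping.single (Poly_Mapping.single v 1) 1"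

definition Const :: "complex \<Rightarrow> mpoly" where
  "Const c = Poly_Mapping.single 0 c"

definition vars :: "nat \<Rightarrow> var set" where
  "vars n = {(k, i, j). k < n \<and> i < 2 \<and> j < 2}"

definition valid_poly :: "nat \<Rightarrow> mpoly \<Rightarrow> bool" where
  "valid_poly n p \<longleftrightarrow> (\<forall>m \<in> Poly_Mapping.keys p. Poly_Mapping.keys m \<subseteq> vars n)"

text \<open>2x2 matrices, entries indexed by 0,1.\<close>
type_synonym 'a mat2 = "nat \<Rightarrow> nat \<Rightarrow> 'a"

definition mmul :: "'a::comm_ring_1 mat2 \<Rightarrow> 'a mat2 \<Rightarrow> 'a mat2" where
  "mmul A B = (\<lambda>i j. A i 0 * B 0 j + A i 1 * B 1 j)"

definition mid :: "'a::comm_ring_1 mat2" where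
  "mid = (\<lambda>i j. if i = j then 1 else 0)"

definition det2 :: "'a::comm_ring_1 mat2 \<Rightarrow> 'a" where
  "det2 A = A 0 0 * A 1 1 - A 0 1 * A 1 0"

text \<open>Adjugate; equals the inverse for matrices of determinant 1.\<close>
definition adj2 :: "'a::comm_ring_1 mat2 \<Rightarrow> 'a mat2" where
  "adj2 A = (\<lambda>i j. if i = 0 \<and> j = 0 then A 1 1 else if i = 0 \<and> j = 1 then - A 0 1
               else if i = 1 \<and> j = 0 then - A 1 0 else A 0 0)"

definition tr2 :: "'a::comm_ring_1 mat2 \<Rightarrow> 'a" where
  "tr2 A = A 0 0 + A 1 1"

definition Xmat :: "nat \<Rightarrow> mpoly mat2" where
  "Xmat k = (\<lambda>i j. Var (k, i, j))"

text \<open>Words in the free group: letters (k, False) = gamma_k, (k, True) = gamma_k^{-1}.\<close>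
type_synonym word = "(nat \<times> bool) list"

fun weval :: "(nat \<Rightarrow> 'a::comm_ring_1 mat2) \<Rightarrow> word \<Rightarrow> 'a mat2" where
  "weval M [] = mid"
| "weval M ((k, b) # w) = mmul (if b then adj2 (M k) else M k) (weval M w)"

definition trpoly :: "word \<Rightarrow> mpoly" where
  "trpoly w = tr2 (weval Xmat w)"

definition gen_ideal :: "nat \<Rightarrow> mpoly set \<Rightarrow> mpoly set" where
  "gen_ideal n S = {p. \<exists>F c. finite F \<and> F \<subseteq> S \<and> (\<forall>s\<in>F. valid_poly n (c s))
                         \<and> p = (\<Sum>s\<in>F. c s * s)}"

definition I_free :: "nat \<Rightarrow> mpoly set" where
  "I_free n = gen_ideal n {det2 (Xmat k) - 1 | k. k < n}"

definition I_pres :: "nat \<Rightarrow> 'l set \<Rightarrow> ('l \<Rightarrow> word) \<Rightarrow> mpoly set" where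
  "I_pres n L r = gen_ideal n ({det2 (Xmat k) - 1 | k. k < n}
       \<union> {weval Xmat (r l) i j - mid i j | l i j. l \<in> L \<and> i < 2 \<and> j < 2})"

definition subst :: "(var \<Rightarrow> mpoly) \<Rightarrow> mpoly \<Rightarrow> mpoly" where
  "subst \<sigma> p = (\<Sum>m\<in>Poly_Mapping.keys p. Const (Poly_Mapping.lookup p m) *
                   (\<Prod>v\<in>Poly_Mapping.keys m. \<sigma> v ^ Poly_Mapping.lookup m v))"

definition conj_act :: "nat \<Rightarrow> complex mat2 \<Rightarrow> mpoly \<Rightarrow> mpoly" where
  "conj_act n g p = subst (\<lambda>v. case v of (k, i, j) \<Rightarrow>
      if (k, i, j) \<in> vars n
      then mmul (mmul (\<lambda>a b. Const (g a b)) (Xmat k)) (\<lambda>a b. Const (adj2 g a b)) i j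
      else Var v) p"

text \<open>p represents an SL_2(C)-invariant class of the quotient by the ideal I.\<close>
definition invariant_mod :: "nat \<Rightarrow> mpoly set \<Rightarrow> mpoly \<Rightarrow> bool" where
  "invariant_mod n I p \<longleftrightarrow> (\<forall>g. det2 g = (1::complex) \<longrightarrow> conj_act n g p - p \<in> I)"

definition kernel_gens :: "nat \<Rightarrow> 'l set \<Rightarrow> ('l \<Rightarrow> word) \<Rightarrow> mpoly set" where
  "kernel_gens n L r =
     {trpoly (r l) - 2 | l. l \<in> L}
   \<union> {trpoly ((i, False) # r l) - trpoly [(i, False)] | l i. l \<in> L \<and> i < n}
   \<union> {trpoly ((j, False) # (k, False) # r l) - trpoly [(j, False), (k, False)]
        | l j k. l \<in> L \<and> j < k \<and> k < n}"

end

(* SL_2(C) is linearly reductive: averaging p(g X g^-1) over g turns any polynomial that is invariant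
   modulo a stable ideal I into an honest invariant congruent to it modulo I, which gives surjectivity.
   If q lies in the relator ideal, then modulo the determinant relations q is a sum of terms
   p * (W - I)_ij with W a relator matrix.  The average of such a term is computed by repeated
   integration by parts (this replaces the first fundamental theorem): it is a polynomial in traces of
   products of the generic matrices and of exactly one factor W - I or its adjugate, so an
   invariant-linear combination of traces tr(A (W - I)) with A a word.  By Cayley-Hamilton, every word is
   an invariant-linear combination of I, X_i and X_j X_k with j < k, and for these A the traces are the
   stated kernel generators.

   The average is a finite weighted sum over points of SL_2(C) that reproduces the Haar moments of SU(2)
   in degrees below N.  Hence no measure theory is needed, and averages visibly stay in an ideal
   containing all p(g X g^-1) - p. *)

theory Submission
  imports Defs
begin

section \<open>Substitution and finite generation\<close>

text \<open>Invariance has to come out of the evaluation itself: the integration by parts that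
  isolates a relator factor also shows, when there is none, that the average lies in every class of
  polynomials that contains the traces and is closed under sums and products. One induction over a
  grading therefore serves surjectivity (degree 0) and the kernel (degree 1).

  Each quadrature rule is exact only below some degree, and no N serves all polynomials. Statements
  about averages therefore hold eventually in N, and the finitely many terms of an ideal element
  share a common N.

  In degree 1, all that is used of a relator matrix is that its traces against I, X_i and X_j X_k
  lie in the kernel ideal. This condition survives what integration by parts does to a matrix:
  multiplication on either side by matrices of degree 0, and passage to the adjugate.\<close>

lemma Const_0 [simp]: "Const 0 = 0"
  and Const_1 [simp]: "Const 1 = 1"
  and Const_add: "Const (a + b) = Const a + Const b"
  and Const_mult: "Const (a * b) = Const a * Const b"
  and Const_uminus: "Const (- a) = - Const a"
  and Const_diff: "Const (a - b) = Const a - Const b"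
  by (simp_all add: Const_def single_add mult_single single_uminus single_diff)

lemma Const_numeral [simp]: "Const (numeral k) = numeral k"
  by (simp add: Const_def)

lemma Const_sum: "Const (sum f A) = (\<Sum>x\<in>A. Const (f x))"
  by (induction A rule: infinite_finite_induct) (simp_all add: Const_add)

lemma Const_half:
  assumes "2 * p = q"
  shows "p = Const (1/2) * q"
proof -
  have "Const (1/2) * q = (Const (1/2) * 2) * p"
    unfolding assms[symmetric] by (simp only: mult.assoc)
  also have "Const (1/2) * 2 = 1"
    using Const_mult[of "1/2" 2] by simp
  finally show ?thesis by simp
qed

definition eval_mon :: "(var \<Rightarrow> mpoly) \<Rightarrow> (var \<Rightarrow>\<^sub>0 nat) \<Rightarrow> mpoly" where
  "eval_mon \<sigma> m = (\<Prod>v\<in>Poly_Mapping.keys m. \<sigma> v ^ Poly_Mapping.lookup m v)"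

lemma eval_mon_superset:
  assumes "finite A" "Poly_Mapping.keys m \<subseteq> A"
  shows "eval_mon \<sigma> m = (\<Prod>v\<in>A. \<sigma> v ^ Poly_Mapping.lookup m v)"
  unfolding eval_mon_def
  by (rule prod.mono_neutral_left) (use assms in \<open>auto simp: in_keys_iff\<close>)

lemma eval_mon_add: "eval_mon \<sigma> (m + m') = eval_mon \<sigma> m * eval_mon \<sigma> m'"
proof -
  define A where "A = Poly_Mapping.keys m \<union> Poly_Mapping.keys m'"
  have A: "finite A" "Poly_Mapping.keys m \<subseteq> A" "Poly_Mapping.keys m' \<subseteq> A"
    "Poly_Mapping.keys (m + m') \<subseteq> A"
    using Poly_Mapping.keys_add[of m m'] by (auto simp: A_def)
  show ?thesis
    by (simp add: A eval_mon_superset[OF A(1)] lookup_add power_add prod.distrib)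
qed

lemma eval_mon_0 [simp]: "eval_mon \<sigma> 0 = 1"
  by (simp add: eval_mon_def)

lemma eval_mon_single: "eval_mon \<sigma> (Poly_Mapping.single v 1) = \<sigma> v"
  by (simp add: eval_mon_def)

lemma subst_eq_eval_mon:
  "subst \<sigma> p = (\<Sum>m\<in>Poly_Mapping.keys p. Const (Poly_Mapping.lookup p m) * eval_mon \<sigma> m)"
  by (simp add: subst_def eval_mon_def)

lemma subst_add: "subst \<sigma> (p + q) = subst \<sigma> p + subst \<sigma> q"
  unfolding subst_eq_eval_mon
  by (rule setsum_keys_plus_distrib) (simp_all add: Const_add distrib_right)

lemma subst_single: "subst \<sigma> (Poly_Mapping.single m c) = Const c * eval_mon \<sigma> m"
  by (cases "c = 0") (simp_all add: subst_eq_eval_mon)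

lemma subst_0 [simp]: "subst \<sigma> 0 = 0"
  by (simp add: subst_def)

text \<open>The monomial step is restricted to monomials of \<open>p\<close> itself, so that a
  condition on the support of \<open>p\<close>, such as \<open>valid_poly\<close>, is available
  there.\<close>

lemma mpoly_induct [case_names 0 single add]:
  fixes p :: mpoly
  assumes "P 0"
    and "\<And>m c. m \<in> Poly_Mapping.keys p \<Longrightarrow> P (Poly_Mapping.single m c)"
    and "\<And>p q. P p \<Longrightarrow> P q \<Longrightarrow> P (p + q)"
  shows "P p"
proof -
  have sums: "P (\<Sum>m\<in>A. Poly_Mapping.single m (Poly_Mapping.lookup p m))"
    if "finite A" "A \<subseteq> Poly_Mapping.keys p" for A
    using that by induction (use assms in auto)
  have "p = (\<Sum>m\<in>Poly_Mapping.keys p. Poly_Mapping.single m (Poly_Mapping.lookup p m))"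
    by (rule poly_mapping_eqI)
       (simp add: lookup_sum lookup_single when_def sum.delta' in_keys_iff)
  with sums[of "Poly_Mapping.keys p"] show ?thesis by simp
qed

lemma subst_mult: "subst \<sigma> (p * q) = subst \<sigma> p * subst \<sigma> q"
proof (induction p rule: mpoly_induct)
  case (single m c)
  show ?case
    by (induction q rule: mpoly_induct)
       (simp_all add: mult_single subst_single eval_mon_add Const_mult subst_add algebra_simps)
qed (simp_all add: subst_add algebra_simps)

lemma subst_Const [simp]: "subst \<sigma> (Const c) = Const c"
  using subst_single[of \<sigma> 0 c] by (simp flip: Const_def)

lemma subst_Var [simp]: "subst \<sigma> (Var v) = \<sigma> v"
  by (simp add: Var_def subst_single eval_mon_single del: One_nat_def)

lemma subst_1 [simp]: "subst \<sigma> 1 = 1"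
  using subst_Const[of \<sigma> 1] by simp

lemma subst_uminus: "subst \<sigma> (- p) = - subst \<sigma> p"
  using subst_add[of \<sigma> p "- p"] by (simp add: eq_neg_iff_add_eq_0 add.commute)

lemma subst_diff: "subst \<sigma> (p - q) = subst \<sigma> p - subst \<sigma> q"
  using subst_add[of \<sigma> p "-q"] by (simp add: subst_uminus)

section \<open>Polynomials in the entries of n generic matrices\<close>

lemma valid_poly_0 [simp]: "valid_poly n 0"
  and valid_poly_Const [simp]: "valid_poly n (Const c)"
  and valid_poly_Var: "v \<in> vars n \<Longrightarrow> valid_poly n (Var v)"
  by (auto simp: valid_poly_def Const_def Var_def)

lemma valid_poly_1 [simp]: "valid_poly n 1"
  using valid_poly_Const[of n 1] by simp

lemma valid_poly_add: "valid_poly n p \<Longrightarrow> valid_poly n q \<Longrightarrow> valid_poly n (p + q)"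
  using Poly_Mapping.keys_add[of p q] by (fastforce simp: valid_poly_def)

lemma valid_poly_mult: "valid_poly n p \<Longrightarrow> valid_poly n q \<Longrightarrow> valid_poly n (p * q)"
  unfolding valid_poly_def
proof (intro ballI subsetI)
  fix m v
  assume p: "\<forall>m\<in>Poly_Mapping.keys p. Poly_Mapping.keys m \<subseteq> vars n"
    and q: "\<forall>m\<in>Poly_Mapping.keys q. Poly_Mapping.keys m \<subseteq> vars n"
    and m: "m \<in> Poly_Mapping.keys (p * q)" and v: "v \<in> Poly_Mapping.keys m"
  from m keys_mult[of p q] obtain a b where
    "a \<in> Poly_Mapping.keys p" "b \<in> Poly_Mapping.keys q" "m = a + b" by blast
  thus "v \<in> vars n" using p q v Poly_Mapping.keys_add[of a b] by blast
qed

lemma valid_poly_uminus: "valid_poly n p \<Longrightarrow> valid_poly n (- p)"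
  using valid_poly_mult[OF valid_poly_Const[of n "-1"], of p] by (simp add: Const_uminus)

lemma valid_poly_diff: "valid_poly n p \<Longrightarrow> valid_poly n q \<Longrightarrow> valid_poly n (p - q)"
  using valid_poly_add[of n p "-q"] by (simp add: valid_poly_uminus)

lemma valid_poly_sum: "(\<And>x. x \<in> A \<Longrightarrow> valid_poly n (f x)) \<Longrightarrow> valid_poly n (sum f A)"
  by (induction A rule: infinite_finite_induct) (simp_all add: valid_poly_add)


text \<open>A list with repetitions instead of an exponent map: each occurrence of a variable later
  becomes one factor of a chain product.\<close>

lemma single_one_eq_prod_list:
  "\<exists>xs. set xs \<subseteq> Poly_Mapping.keys m \<and> Poly_Mapping.single m (1::complex) = prod_list (map Var xs)"
proof (induction m rule: update_induct)
  case const
  show ?case by (rule exI[of _ "[]"]) simp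
next
  case (update f v b)
  then obtain xs where xs: "set xs \<subseteq> Poly_Mapping.keys f"
    "Poly_Mapping.single f (1::complex) = prod_list (map Var xs)" by blast
  have eq: "Poly_Mapping.update v b f = Poly_Mapping.single v b + f"
    using update by (intro poly_mapping_eqI)
      (auto simp: lookup_update lookup_add lookup_single when_def in_keys_iff)
  have pow: "Poly_Mapping.single (Poly_Mapping.single v b) (1::complex) = prod_list (map Var (replicate b v))"

  proof (induction b)
    case (Suc b)
    have "Poly_Mapping.single (Poly_Mapping.single v (Suc b)) (1::complex)
        = Var v * Poly_Mapping.single (Poly_Mapping.single v b) 1"
      unfolding Var_def mult_single by (simp flip: single_add)
    with Suc show ?case by simp
  qed simp
  show ?case
  proof (intro exI conjI)
    show "set (replicate b v @ xs) \<subseteq> Poly_Mapping.keys (Poly_Mapping.update v b f)"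
      using xs(1) update by (auto simp: keys_update)
    have "Poly_Mapping.single (Poly_Mapping.update v b f) (1::complex)
        = Poly_Mapping.single (Poly_Mapping.single v b) 1 * Poly_Mapping.single f 1"
      by (simp add: eq mult_single)
    thus "Poly_Mapping.single (Poly_Mapping.update v b f) (1::complex)
        = prod_list (map Var (replicate b v @ xs))"
      by (simp only: pow xs(2) map_append prod_list.append)
  qed
qed

lemma valid_poly_induct [consumes 1, case_names monomial add]:
  assumes "valid_poly n p"
    and "\<And>c xs. set xs \<subseteq> vars n \<Longrightarrow> P (Const c * prod_list (map Var xs))"
    and "\<And>p q. P p \<Longrightarrow> P q \<Longrightarrow> P (p + q)"
  shows "P p"
proof (induction p rule: mpoly_induct)
  case 0
  show ?case using assms(2)[of "[]" 0] by simp
next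
  case (single m c)
  obtain xs where xs: "set xs \<subseteq> Poly_Mapping.keys m"
    "Poly_Mapping.single m (1::complex) = prod_list (map Var xs)"
    using single_one_eq_prod_list by blast
  have "Poly_Mapping.single m c = Const c * prod_list (map Var xs)"
    by (simp add: Const_def mult_single flip: xs(2))
  moreover have "set xs \<subseteq> vars n" using xs(1) single assms(1) by (auto simp: valid_poly_def)
  ultimately show ?case using assms(2) by simp
qed (rule assms(3))

text \<open>The predicate stands for the ring of coefficients: \<open>valid_poly n\<close> gives
  ideals of the polynomial ring, \<open>invariant n\<close> gives ideals of the ring of
  invariants.\<close>

definition lin_comb :: "(mpoly \<Rightarrow> bool) \<Rightarrow> mpoly set \<Rightarrow> mpoly set" where
  "lin_comb P S = {p. \<exists>F c. finite F \<and> F \<subseteq> S \<and> (\<forall>s\<in>F. P (c s)) \<and> p = (\<Sum>s\<in>F. c s * s)}"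

lemma gen_ideal_eq_lin_comb: "gen_ideal n = lin_comb (valid_poly n)"
  by (simp add: gen_ideal_def lin_comb_def fun_eq_iff)

lemma lin_comb_0 [simp]: "0 \<in> lin_comb P S"
  unfolding lin_comb_def by (auto intro!: exI[of _ "{}"])

lemma lin_comb_mult:
  assumes "P a" "p \<in> lin_comb P S" "\<And>x y. P x \<Longrightarrow> P y \<Longrightarrow> P (x * y)"
  shows "a * p \<in> lin_comb P S"
proof -
  obtain F c where "finite F" "F \<subseteq> S" "\<forall>s\<in>F. P (c s)" "p = (\<Sum>s\<in>F. c s * s)"
    using assms(2) by (auto simp: lin_comb_def)
  with assms show ?thesis
    unfolding lin_comb_def
    by (auto intro!: exI[of _ F] exI[of _ "\<lambda>s. a * c s"] simp: sum_distrib_left mult.assoc)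
qed

lemma lin_comb_base: "s \<in> S \<Longrightarrow> P 1 \<Longrightarrow> s \<in> lin_comb P S"
  unfolding lin_comb_def by (auto intro!: exI[of _ "{s}"] exI[of _ "\<lambda>_. 1"])

lemma lin_comb_mono: "S \<subseteq> S' \<Longrightarrow> lin_comb P S \<subseteq> lin_comb P S'"
  unfolding lin_comb_def by blast

lemma lin_comb_add:
  assumes "p \<in> lin_comb P S" "q \<in> lin_comb P S" "P 0" "\<And>x y. P x \<Longrightarrow> P y \<Longrightarrow> P (x + y)"
  shows "p + q \<in> lin_comb P S"
proof -
  obtain F c where F: "finite F" "F \<subseteq> S" "\<forall>s\<in>F. P (c s)" "p = (\<Sum>s\<in>F. c s * s)"
    using assms(1) by (auto simp: lin_comb_def)
  obtain G d where G: "finite G" "G \<subseteq> S" "\<forall>s\<in>G. P (d s)" "q = (\<Sum>s\<in>G. d s * s)"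
    using assms(2) by (auto simp: lin_comb_def)
  define c' d' where "c' s = (if s \<in> F then c s else 0)" and "d' s = (if s \<in> G then d s else 0)" for s
  have "p = (\<Sum>s\<in>F \<union> G. c' s * s)"
    unfolding F(4) by (rule sum.mono_neutral_cong_left) (use F G in \<open>auto simp: c'_def\<close>)
  moreover have "q = (\<Sum>s\<in>F \<union> G. d' s * s)"
    unfolding G(4) by (rule sum.mono_neutral_cong_left) (use F G in \<open>auto simp: d'_def\<close>)
  ultimately have "p + q = (\<Sum>s\<in>F \<union> G. (c' s + d' s) * s)"
    by (simp add: sum.distrib distrib_right)
  moreover have "\<forall>s\<in>F \<union> G. P (c' s + d' s)"
    using F G assms(3,4) by (auto simp: c'_def d'_def)
  ultimately show ?thesis
    using F G unfolding lin_comb_def by (auto intro!: exI[of _ "F \<union> G"] exI[of _ "\<lambda>s. c' s + d' s"])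
qed

section \<open>Invariants and equivariant matrices\<close>

definition conj2 :: "'a::comm_ring_1 mat2 \<Rightarrow> 'a mat2 \<Rightarrow> 'a mat2" where
  "conj2 G A = mmul (mmul G A) (adj2 G)"

abbreviation Const_mat :: "complex mat2 \<Rightarrow> mpoly mat2" where
  "Const_mat g \<equiv> \<lambda>a b. Const (g a b)"

lemma adj2_Const_mat: "(\<lambda>a b. Const (adj2 g a b)) = adj2 (Const_mat g)"
  by (auto simp: adj2_def fun_eq_iff Const_uminus)

lemma det2_Const_mat: "det2 (Const_mat g) = Const (det2 g)"
  by (simp add: det2_def Const_diff Const_mult)

lemma all_less_2: "(\<forall>i<2. P i) \<longleftrightarrow> P 0 \<and> P (1::nat)"
  by (auto simp: less_2_cases_iff)

lemma mmul_assoc: "mmul (mmul A B) C = mmul A (mmul B C)"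
  by (simp add: mmul_def fun_eq_iff algebra_simps)

lemma adj2_simps [simp]:
  "adj2 A 0 0 = A 1 1" "adj2 A 0 1 = - A 0 1" "adj2 A 1 0 = - A 1 0" "adj2 A 1 1 = A 0 0"
  "adj2 A 0 (Suc 0) = - A 0 1" "adj2 A (Suc 0) 0 = - A 1 0" "adj2 A (Suc 0) (Suc 0) = A 0 0"
  by (simp_all add: adj2_def)

text \<open>Matrices are functions on all pairs of naturals, so \<open>mmul (adj2 G) G\<close>
  agrees with \<open>mid\<close> only at indices below 2. Cancelling inside a product avoids this,
  because \<open>mmul A\<close> reads only rows 0 and 1 of its right factor.\<close>

lemma mmul_adj2_mmul:
  assumes "det2 G = 1"
  shows "mmul A (mmul (adj2 G) (mmul G B)) = mmul A B"
proof -
  have "mmul (adj2 G) (mmul G B) 0 j = B 0 j" "mmul (adj2 G) (mmul G B) 1 j = B 1 j" for j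
  proof -
    have "mmul (adj2 G) (mmul G B) 0 j = det2 G * B 0 j" "mmul (adj2 G) (mmul G B) 1 j = det2 G * B 1 j"
      by (simp_all add: mmul_def det2_def algebra_simps)
    thus "mmul (adj2 G) (mmul G B) 0 j = B 0 j" "mmul (adj2 G) (mmul G B) 1 j = B 1 j"
      by (simp_all add: assms)
  qed
  thus ?thesis unfolding mmul_def[of A] by simp
qed

lemma conj2_mmul: "det2 G = 1 \<Longrightarrow> conj2 G (mmul A B) = mmul (conj2 G A) (conj2 G B)"
  by (simp add: conj2_def mmul_assoc mmul_adj2_mmul)

lemma mid_simps [simp]:
  "mid 0 0 = 1" "mid 0 1 = 0" "mid 1 0 = 0" "mid 1 1 = 1"
  "mid 0 (Suc 0) = 0" "mid (Suc 0) 0 = 0" "mid (Suc 0) (Suc 0) = 1"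
  by (simp_all add: mid_def)

lemma conj2_mid:
  assumes "det2 G = 1" "i < 2" "j < 2"
  shows "conj2 G mid i j = mid i j"
proof -
  have "conj2 G mid i j = det2 G * mid i j"
    using assms(2,3) by (auto simp: less_2_cases_iff conj2_def mmul_def det2_def algebra_simps)
  thus ?thesis by (simp add: assms)
qed

lemma tr2_conj2: "tr2 (conj2 G A) = det2 G * tr2 A"
  by (simp add: conj2_def mmul_def tr2_def det2_def algebra_simps)

lemma det2_conj2: "det2 (conj2 G A) = det2 G * det2 G * det2 A"
  by (simp add: conj2_def mmul_def det2_def algebra_simps)

lemma conj_act_add: "conj_act n g (p + q) = conj_act n g p + conj_act n g q"
  and conj_act_mult: "conj_act n g (p * q) = conj_act n g p * conj_act n g q"
  and conj_act_diff: "conj_act n g (p - q) = conj_act n g p - conj_act n g q"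
  and conj_act_Const [simp]: "conj_act n g (Const c) = Const c"
  and conj_act_0 [simp]: "conj_act n g 0 = 0"
  and conj_act_1 [simp]: "conj_act n g 1 = 1"
  by (simp_all add: conj_act_def subst_add subst_mult subst_diff)

lemma conj_act_prod_list: "conj_act n g (prod_list ps) = prod_list (map (conj_act n g) ps)"
  by (induction ps) (simp_all add: conj_act_mult)

lemma conj_act_Var:
  "(k, i, j) \<in> vars n \<Longrightarrow> conj_act n g (Var (k, i, j)) = conj2 (Const_mat g) (Xmat k) i j"
  by (simp add: conj_act_def conj2_def adj2_Const_mat)

definition valid_mat :: "nat \<Rightarrow> mpoly mat2 \<Rightarrow> bool" where
  "valid_mat n A \<longleftrightarrow> (\<forall>i<2. \<forall>j<2. valid_poly n (A i j))"

lemma valid_mat_mmul: "valid_mat n A \<Longrightarrow> valid_mat n B \<Longrightarrow> valid_mat n (mmul A B)"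
  by (auto simp: valid_mat_def mmul_def intro!: valid_poly_add valid_poly_mult)

lemma valid_mat_adj2: "valid_mat n A \<Longrightarrow> valid_mat n (adj2 A)"
  by (auto simp: valid_mat_def all_less_2 intro!: valid_poly_uminus)

lemma valid_mat_Const_mat: "valid_mat n (Const_mat g)"
  by (simp add: valid_mat_def)

lemma valid_mat_mid: "valid_mat n mid"
  by (simp add: valid_mat_def mid_def)

lemma valid_mat_Xmat: "k < n \<Longrightarrow> valid_mat n (Xmat k)"
  by (auto simp: valid_mat_def Xmat_def vars_def intro!: valid_poly_Var)

lemma valid_poly_prod_list: "(\<And>p. p \<in> set ps \<Longrightarrow> valid_poly n p) \<Longrightarrow> valid_poly n (prod_list ps)"
  by (induction ps) (simp_all add: valid_poly_mult)

lemma valid_poly_conj_act: "valid_poly n p \<Longrightarrow> valid_poly n (conj_act n g p)"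
proof (induction rule: valid_poly_induct)
  case (monomial c xs)
  have "valid_poly n (conj_act n g (Var v))" if v: "v \<in> vars n" for v
  proof -
    obtain k i j where [simp]: "v = (k, i, j)" by (cases v)
    have "k < n" "i < 2" "j < 2" using v by (auto simp: vars_def)
    moreover have "valid_mat n (conj2 (Const_mat g) (Xmat k))" if "k < n"
      unfolding conj2_def
      by (intro valid_mat_mmul valid_mat_adj2 valid_mat_Const_mat valid_mat_Xmat that)
    ultimately show ?thesis using v by (auto simp: conj_act_Var valid_mat_def)
  qed
  hence "\<forall>v\<in>set xs. valid_poly n (conj_act n g (Var v))" using monomial by blast
  hence "valid_poly n (prod_list (map (\<lambda>v. conj_act n g (Var v)) xs))"
    by (intro valid_poly_prod_list) auto
  thus ?case
    by (auto simp: conj_act_mult conj_act_prod_list o_def intro!: valid_poly_mult)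
qed (simp add: conj_act_add valid_poly_add)

definition invariant :: "nat \<Rightarrow> mpoly \<Rightarrow> bool" where
  "invariant n p \<longleftrightarrow> valid_poly n p \<and> (\<forall>g. det2 g = 1 \<longrightarrow> conj_act n g p = p)"

lemma invariant_0 [simp]: "invariant n 0"
  and invariant_1 [simp]: "invariant n 1"
  and invariant_Const [simp]: "invariant n (Const c)"
  by (simp_all add: invariant_def)

lemma invariant_add: "invariant n p \<Longrightarrow> invariant n q \<Longrightarrow> invariant n (p + q)"
  and invariant_diff: "invariant n p \<Longrightarrow> invariant n q \<Longrightarrow> invariant n (p - q)"
  and invariant_mult: "invariant n p \<Longrightarrow> invariant n q \<Longrightarrow> invariant n (p * q)"
  by (simp_all add: invariant_def valid_poly_add valid_poly_diff valid_poly_mult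
      conj_act_add conj_act_diff conj_act_mult)

definition equivariant :: "nat \<Rightarrow> mpoly mat2 \<Rightarrow> bool" where
  "equivariant n A \<longleftrightarrow> valid_mat n A \<and> (\<forall>g. det2 g = 1 \<longrightarrow>
     (\<forall>i<2. \<forall>j<2. conj_act n g (A i j) = conj2 (Const_mat g) A i j))"

lemma conj2_cong:
  "(\<And>i j. i < 2 \<Longrightarrow> j < 2 \<Longrightarrow> A i j = B i j) \<Longrightarrow> conj2 G A = conj2 G B"
  by (simp add: conj2_def mmul_def)

lemma equivariant_cong:
  assumes "equivariant n A" "\<And>i j. i < 2 \<Longrightarrow> j < 2 \<Longrightarrow> A i j = B i j"
  shows "equivariant n B"
  using assms conj2_cong[of A B] by (auto simp: equivariant_def valid_mat_def)

lemma equivariant_mid: "equivariant n mid"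
  unfolding equivariant_def by (simp add: valid_mat_mid conj2_mid det2_Const_mat) (simp add: mid_def)

lemma equivariant_Xmat: "k < n \<Longrightarrow> equivariant n (Xmat k)"
  unfolding equivariant_def
  by (simp add: valid_mat_Xmat) (simp add: Xmat_def[of k] vars_def conj_act_Var)

lemma equivariant_mmul:
  assumes A: "equivariant n A" and B: "equivariant n B"
  shows "equivariant n (mmul A B)"
  unfolding equivariant_def
proof (intro conjI allI impI)
  show "valid_mat n (mmul A B)" using A B by (auto simp: equivariant_def intro: valid_mat_mmul)
next
  fix g i j assume g: "det2 g = (1::complex)" and ij: "i < (2::nat)" "j < (2::nat)"
  have "conj_act n g (mmul A B i j) = mmul (conj2 (Const_mat g) A) (conj2 (Const_mat g) B) i j"
    using A B g ij by (simp add: mmul_def[of A B] mmul_def[of "conj2 _ _"]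
        conj_act_add conj_act_mult equivariant_def)
  thus "conj_act n g (mmul A B i j) = conj2 (Const_mat g) (mmul A B) i j"
    by (simp add: conj2_mmul det2_Const_mat g)
qed

lemma equivariant_add:
  "equivariant n A \<Longrightarrow> equivariant n B \<Longrightarrow> equivariant n (\<lambda>i j. A i j + B i j)"
  by (auto simp: equivariant_def valid_mat_def conj_act_add conj2_def mmul_def algebra_simps
      intro!: valid_poly_add)

lemma equivariant_scale:
  "invariant n b \<Longrightarrow> equivariant n A \<Longrightarrow> equivariant n (\<lambda>i j. b * A i j)"
  by (auto simp: equivariant_def invariant_def valid_mat_def conj_act_mult conj2_def mmul_def
      algebra_simps intro!: valid_poly_mult)

lemma invariant_tr2:
  assumes "equivariant n A"
  shows "invariant n (tr2 A)"
  unfolding invariant_def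
proof (intro conjI allI impI)
  show "valid_poly n (tr2 A)"
    using assms by (auto simp: equivariant_def valid_mat_def tr2_def intro: valid_poly_add)
next
  fix g assume g: "det2 g = (1::complex)"
  have "conj_act n g (tr2 A) = tr2 (conj2 (Const_mat g) A)"
    using assms g by (simp add: equivariant_def tr2_def conj_act_add)
  thus "conj_act n g (tr2 A) = tr2 A" by (simp add: tr2_conj2 det2_Const_mat g)
qed

lemma invariant_det2:
  assumes "equivariant n A"
  shows "invariant n (det2 A)"
  unfolding invariant_def
proof (intro conjI allI impI)
  show "valid_poly n (det2 A)"
    using assms by (auto simp: equivariant_def valid_mat_def det2_def
        intro!: valid_poly_diff valid_poly_mult)
next
  fix g assume g: "det2 g = (1::complex)"
  have "conj_act n g (det2 A) = det2 (conj2 (Const_mat g) A)"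
    using assms g by (simp add: equivariant_def det2_def conj_act_diff conj_act_mult)
  thus "conj_act n g (det2 A) = det2 A" by (simp add: det2_conj2 det2_Const_mat g)
qed

section \<open>Cayley--Hamilton reduction of words\<close>

text \<open>The module over the invariants spanned by the words against which relators are tested.
  The rule \<open>cong\<close> is needed because matrix identities hold only at indices below
  2.\<close>

inductive_set std_span :: "nat \<Rightarrow> mpoly mat2 set" for n where
  one: "mid \<in> std_span n"
| gen: "i < n \<Longrightarrow> Xmat i \<in> std_span n"
| pair: "j < k \<Longrightarrow> k < n \<Longrightarrow> mmul (Xmat j) (Xmat k) \<in> std_span n"
| add: "A \<in> std_span n \<Longrightarrow> B \<in> std_span n \<Longrightarrow> (\<lambda>i j. A i j + B i j) \<in> std_span n"
| scale: "invariant n b \<Longrightarrow> A \<in> std_span n \<Longrightarrow> (\<lambda>i j. b * A i j) \<in> std_span n"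
| cong: "A \<in> std_span n \<Longrightarrow> (\<And>i j. i < 2 \<Longrightarrow> j < 2 \<Longrightarrow> A i j = B i j) \<Longrightarrow> B \<in> std_span n"

lemma std_span_equivariant: "A \<in> std_span n \<Longrightarrow> equivariant n A"
proof (induction rule: std_span.induct)
  case (cong A B)
  thus ?case using equivariant_cong by blast
qed (simp_all add: equivariant_mid equivariant_Xmat equivariant_mmul equivariant_add equivariant_scale)

lemma std_span_diff:
  assumes "A \<in> std_span n" "B \<in> std_span n"
  shows "(\<lambda>i j. A i j - B i j) \<in> std_span n"
proof -
  have "(\<lambda>i j. Const (-1) * B i j) \<in> std_span n"
    by (rule std_span.scale) (use assms in auto)
  from std_span.add[OF assms(1) this] show ?thesis by (simp add: Const_uminus)
qed

text \<open>Cayley-Hamilton polarised, that is, AB + BA expressed through A, B and I. It reorders a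
  product X_j X_k with j > k.\<close>

lemma swap_mmul:
  assumes "i < 2" "j < 2"
  shows "mmul B A i j = tr2 A * B i j + tr2 B * A i j + (tr2 (mmul A B) - tr2 A * tr2 B) * mid i j
           - mmul A B i j"
  using assms by (auto simp: less_2_cases_iff mmul_def tr2_def algebra_simps)

lemma square_mmul:
  assumes "i < 2" "j < 2"
  shows "mmul A A i j = tr2 A * A i j - det2 A * mid i j"
  using assms by (auto simp: less_2_cases_iff mmul_def tr2_def det2_def algebra_simps)

text \<open>Writing {A, B} = AB + BA, this is 2ABC = {A, B}C - B{A, C} + {A, BC} with each
  anticommutator expanded by the polarised Cayley--Hamilton identity.\<close>

lemma triple_mmul:
  assumes "i < 2" "j < 2"
  shows "2 * mmul A (mmul B C) i j =
     tr2 A * mmul B C i j + tr2 B * mmul A C i j - tr2 C * mmul B A i j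
   + (tr2 (mmul A B) - tr2 A * tr2 B) * C i j - (tr2 (mmul A C) - tr2 A * tr2 C) * B i j
   + tr2 (mmul B C) * A i j + (tr2 (mmul A (mmul B C)) - tr2 A * tr2 (mmul B C)) * mid i j"
  using assms by (auto simp: less_2_cases_iff mmul_def tr2_def algebra_simps)

lemma std_span_Xmat_mmul_Xmat:
  assumes "j < n" "k < n"
  shows "mmul (Xmat j) (Xmat k) \<in> std_span n"
proof (cases j k rule: linorder_cases)
  case less
  thus ?thesis using assms std_span.pair by blast
next
  case equal
  have "(\<lambda>a b. tr2 (Xmat k) * Xmat k a b - det2 (Xmat k) * mid a b) \<in> std_span n"
    using assms by (intro std_span_diff std_span.scale std_span.one std_span.gen
        invariant_tr2 invariant_det2 equivariant_Xmat)
  thus ?thesis by (rule std_span.cong) (simp add: equal square_mmul)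
next
  case greater
  have "(\<lambda>a b. tr2 (Xmat k) * Xmat j a b + tr2 (Xmat j) * Xmat k a b +
     (tr2 (mmul (Xmat k) (Xmat j)) - tr2 (Xmat k) * tr2 (Xmat j)) * mid a b
     - mmul (Xmat k) (Xmat j) a b) \<in> std_span n"
    using assms greater
    by (intro std_span_diff std_span.add std_span.scale std_span.one std_span.gen std_span.pair
        invariant_diff invariant_mult invariant_tr2 equivariant_mmul equivariant_Xmat)
  thus ?thesis by (rule std_span.cong) (simp add: swap_mmul[of _ _ "Xmat j" "Xmat k"])
qed

lemma std_span_Xmat_mmul:
  assumes "i < n" "A \<in> std_span n"
  shows "mmul (Xmat i) A \<in> std_span n"
  using assms(2)
proof (induction rule: std_span.induct)
  case one
  show ?case by (rule std_span.cong[OF std_span.gen[OF assms(1)]])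
      (auto simp: less_2_cases_iff mmul_def)
next
  case (gen j)
  thus ?case by (rule std_span_Xmat_mmul_Xmat[OF assms(1)])
next
  case (pair j k)
  let ?A = "Xmat i" and ?B = "Xmat j" and ?C = "Xmat k"
  have less: "i < n" "j < n" "k < n" using assms(1) pair by auto
  \<comment> \<open>The right-hand side of \<open>triple_mmul\<close>, halved. It involves only
    products of two generators, which lie in the span in either order and also when the two indices
    coincide.\<close>
  have "(\<lambda>a b. Const (1/2) * (tr2 ?A * mmul ?B ?C a b + tr2 ?B * mmul ?A ?C a b - tr2 ?C * mmul ?B ?A a b
   + (tr2 (mmul ?A ?B) - tr2 ?A * tr2 ?B) * ?C a b - (tr2 (mmul ?A ?C) - tr2 ?A * tr2 ?C) * ?B a b
   + tr2 (mmul ?B ?C) * ?A a b + (tr2 (mmul ?A (mmul ?B ?C)) - tr2 ?A * tr2 (mmul ?B ?C)) * mid a b))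
    \<in> std_span n"
    using less
    by (intro std_span_diff std_span.add std_span.scale std_span.one std_span.gen
        std_span_Xmat_mmul_Xmat invariant_Const
        invariant_diff invariant_mult invariant_tr2 equivariant_mmul equivariant_Xmat)
  thus ?case by (rule std_span.cong) (rule sym, rule Const_half, rule triple_mmul)
next
  case (add A B)
  from std_span.add[OF add.IH] show ?case
    by (rule std_span.cong) (simp add: mmul_def algebra_simps)
next
  case (scale b A)
  from std_span.scale[OF scale(1) scale.IH] show ?case
    by (rule std_span.cong) (simp add: mmul_def algebra_simps)
next
  case (cong A B)
  from cong.IH show ?case
    by (rule std_span.cong) (simp add: mmul_def cong.hyps)
qed

lemma std_span_mmul:
  assumes "A \<in> std_span n" "B \<in> std_span n"
  shows "mmul A B \<in> std_span n"
  using assms(1)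
proof (induction rule: std_span.induct)
  case one
  show ?case by (rule std_span.cong[OF assms(2)]) (auto simp: less_2_cases_iff mmul_def)
next
  case (pair j k)
  thus ?case using assms(2) by (simp add: mmul_assoc std_span_Xmat_mmul)
next
  case (add A A')
  from std_span.add[OF add.IH] show ?case
    by (rule std_span.cong) (simp add: mmul_def algebra_simps)
next
  case (scale b A)
  from std_span.scale[OF scale(1) scale.IH] show ?case
    by (rule std_span.cong) (simp add: mmul_def algebra_simps)
next
  case (cong A A')
  from cong.IH show ?case
    by (rule std_span.cong) (simp add: mmul_def cong.hyps)
qed (simp add: std_span_Xmat_mmul assms)

lemma adj2_eq: "i < 2 \<Longrightarrow> j < 2 \<Longrightarrow> adj2 A i j = tr2 A * mid i j - A i j"
  by (auto simp: less_2_cases_iff tr2_def)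

lemma std_span_adj2:
  assumes "A \<in> std_span n"
  shows "adj2 A \<in> std_span n"
proof -
  have "(\<lambda>i j. tr2 A * mid i j - A i j) \<in> std_span n"
    by (intro std_span_diff std_span.scale std_span.one invariant_tr2 std_span_equivariant assms)
  thus ?thesis by (rule std_span.cong) (simp add: adj2_eq)
qed

lemma std_span_weval: "\<forall>(k, b) \<in> set w. k < n \<Longrightarrow> weval Xmat w \<in> std_span n"
proof (induction w)
  case (Cons x w)
  obtain k b where "x = (k, b)" by (cases x)
  with Cons show ?case by (auto intro!: std_span_mmul std_span_adj2 std_span.gen)
qed (simp add: std_span.one)

section \<open>Quadrature for the Haar moments\<close>

text \<open>Orthogonality of the characters of a cyclic group; the bounds on a and b turn congruence
  modulo N into equality.\<close>

lemma sum_roots_unity_powers: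
  fixes N a b :: nat
  assumes "a < N" "b < N"
  shows "(\<Sum>z | z ^ N = 1. z ^ a * inverse z ^ b) = (if a = b then of_nat N else (0::complex))"
proof -
  define \<omega> where "\<omega> k = cis (2 * pi * real k / real N)" for k
  have N: "N > 0" using assms by simp
  have bij: "bij_betw \<omega> {..<N} {z. z ^ N = 1}"
    unfolding \<omega>_def by (rule bij_betw_roots_unity[OF N])
  have pow: "\<omega> k = \<omega> 1 ^ k" for k
    by (simp add: \<omega>_def Complex.DeMoivre mult_ac)
  \<comment> \<open>Since \<omega> k ^ a = \<omega> a ^ k, the summand at \<omega> k is x ^ k, and
    the sum becomes geometric.\<close>
  define x where "x = \<omega> a * inverse (\<omega> b)"
  have nz: "\<omega> k \<noteq> 0" for k by (simp add: \<omega>_def)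
  have "\<omega> k ^ N = 1" for k
  proof -
    have "\<omega> k ^ N = cis (2 * pi * real k)" using N by (simp add: \<omega>_def Complex.DeMoivre)
    thus ?thesis by (simp add: cis_multiple_2pi)
  qed
  hence xN: "x ^ N = 1" by (simp add: x_def power_mult_distrib power_inverse)
  have "(\<Sum>z | z ^ N = 1. z ^ a * inverse z ^ b) = (\<Sum>k<N. \<omega> k ^ a * inverse (\<omega> k) ^ b)"
    by (rule sum.reindex_bij_betw[OF bij, symmetric])
  also have "\<dots> = (\<Sum>k<N. x ^ k)"
  proof (rule sum.cong[OF refl])
    fix k
    have "\<omega> k ^ a = \<omega> a ^ k" for a
      by (subst (1 2) pow) (simp add: mult.commute flip: power_mult)
    thus "\<omega> k ^ a * inverse (\<omega> k) ^ b = x ^ k"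
      by (simp add: x_def power_mult_distrib power_inverse)
  qed
  also have "\<dots> = (if a = b then of_nat N else 0)"
  proof (cases "a = b")
    case True
    hence "x = 1" using nz by (simp add: x_def)
    thus ?thesis using True by simp
  next
    case False
    have "\<omega> a \<noteq> \<omega> b"
      using bij_betw_imp_inj_on[OF bij] assms False by (auto dest: inj_onD)
    hence "x \<noteq> 1" using nz by (auto simp: x_def field_simps)
    thus ?thesis using False xN by (simp add: sum_gp_strict)
  qed
  finally show ?thesis .
qed

text \<open>Discrete Fourier inversion: these weights on the N-th roots of unity reproduce the moments
  1/(k+1) of the uniform distribution on [0,1] for all k < N.\<close>

definition moment_weight :: "nat \<Rightarrow> complex \<Rightarrow> complex" where
  "moment_weight N u = (\<Sum>j<N. inverse u ^ j / of_nat (j + 1)) / of_nat N"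

lemma sum_moment_weight_power:
  assumes "k < N"
  shows "(\<Sum>u | u ^ N = 1. moment_weight N u * u ^ k) = 1 / of_nat (k + 1)"
proof -
  have "(\<Sum>u | u ^ N = 1. moment_weight N u * u ^ k)
      = (\<Sum>u | u ^ N = 1. \<Sum>j<N. (u ^ k * inverse u ^ j) / of_nat (j + 1) / of_nat N)"
    by (simp add: moment_weight_def sum_divide_distrib sum_distrib_right sum_distrib_left mult_ac)
  also have "\<dots> = (\<Sum>j<N. (\<Sum>u | u ^ N = 1. u ^ k * inverse u ^ j) / of_nat (j + 1) / of_nat N)"
    by (subst sum.swap) (simp add: sum_divide_distrib)
  also have "\<dots> = (\<Sum>j<N. if k = j then 1 / of_nat (k + 1) else 0)"
    by (rule sum.cong) (use assms in \<open>auto simp: sum_roots_unity_powers\<close>)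
  finally show ?thesis using assms by simp
qed

text \<open>The right-hand side is the Beta integral B(p+1, q+1). Writing one factor 1 - u as a
  difference lowers q at the cost of a term with larger p, hence the induction on q for arbitrary
  p.\<close>

lemma sum_moment_weight_beta:
  assumes "p + q < N"
  shows "(\<Sum>u | u ^ N = 1. moment_weight N u * (u ^ p * (1 - u) ^ q)) = fact p * fact q / fact (p + q + 1)"
  using assms
proof (induction q arbitrary: p)
  case 0
  thus ?case by (simp add: sum_moment_weight_power)
next
  case (Suc q)
  have "(\<Sum>u | u ^ N = 1. moment_weight N u * (u ^ p * (1 - u) ^ Suc q))
    = (\<Sum>u | u ^ N = 1. moment_weight N u * (u ^ p * (1 - u) ^ q))
    - (\<Sum>u | u ^ N = 1. moment_weight N u * (u ^ Suc p * (1 - u) ^ q))"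
    by (simp add: algebra_simps flip: sum_subtractf)
  also have "\<dots> = fact p * fact q / fact (p + q + 1) - fact (Suc p) * fact q / fact (Suc p + q + 1)"
    using Suc.prems by (simp only: Suc.IH)
  also have "\<dots> = fact p * fact (Suc q) / fact (p + Suc q + 1)"
  proof -
    \<comment> \<open>Over the common denominator x * f the claim reduces to x - (p+1) =
      q+1.\<close>
    define x f where "x = (of_nat (p + q + 2) :: complex)" and "f = (fact (p + q + 1) :: complex)"
    have nz: "x \<noteq> 0" "f \<noteq> 0" by (simp_all add: x_def f_def del: of_nat_add of_nat_Suc fact_Suc)
    have "fact (Suc p + q + 1) = x * f" "fact (p + Suc q + 1) = x * f"
      by (simp_all add: x_def f_def)
    moreover have "x = of_nat (Suc p) + of_nat (Suc q)" by (simp add: x_def)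
    ultimately show ?thesis
      unfolding f_def[symmetric] using nz by (simp add: divide_simps) (simp add: algebra_simps)
  qed
  finally show ?case .
qed

section \<open>A quadrature rule for monomials on SL_2(C)\<close>

definition coord_mon :: "nat \<Rightarrow> nat \<Rightarrow> nat \<Rightarrow> nat \<Rightarrow> complex mat2 \<Rightarrow> complex" where
  "coord_mon p q r s g = g 0 0 ^ p * g 0 1 ^ q * g 1 0 ^ r * g 1 1 ^ s"

text \<open>The integral of the monomial over SU(2), on which u = |g_00|^2 is uniformly distributed in [0,1].\<close>

definition haar_moment :: "nat \<Rightarrow> nat \<Rightarrow> nat \<Rightarrow> nat \<Rightarrow> complex" where
  "haar_moment p q r s =
     (if p = s \<and> q = r then (-1) ^ q * fact p * fact q / fact (p + q + 1) else 0)"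

text \<open>Cartan coordinates: s and t run over the diagonal torus on either side (finite subgroups suffice in
  bounded degree), u = |g_00|^2 over the nodes of the quadrature on [0,1], moved to complex roots of unity.\<close>

definition node :: "complex \<times> complex \<times> complex \<Rightarrow> complex mat2" where
  "node = (\<lambda>(s, t, u) i j. if i = 0 then (if j = 0 then csqrt u * s else csqrt (1 - u) * t)
     else (if j = 0 then - csqrt (1 - u) * inverse t else csqrt u * inverse s))"

definition nodes :: "nat \<Rightarrow> (complex \<times> complex \<times> complex) set" where
  "nodes N = {s. s ^ N = 1} \<times> {t. t ^ N = 1} \<times> {u. u ^ N = 1}"

definition weight :: "nat \<Rightarrow> complex \<times> complex \<times> complex \<Rightarrow> complex" where
  "weight N = (\<lambda>(s, t, u). moment_weight N u / of_nat N ^ 2)"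

lemma det2_node: "N > 0 \<Longrightarrow> x \<in> nodes N \<Longrightarrow> det2 (node x) = 1"
proof -
  assume N: "N > 0" and x: "x \<in> nodes N"
  obtain s t u where stu: "x = (s, t, u)" by (cases x)
  have "s \<noteq> 0" "t \<noteq> 0" using N x by (auto simp: nodes_def stu power_0_left)
  hence "det2 (node x) = (csqrt u)\<^sup>2 + (csqrt (1 - u))\<^sup>2"
    by (simp add: det2_def node_def stu power2_eq_square field_simps)
  thus ?thesis by simp
qed

text \<open>The two torus sums force p = s and q = r, and the sum over u is then a Beta integral.
  The bound on the total degree keeps every exponent in these sums below N.\<close>

lemma quadrature:
  assumes "p + q + r + s < N"
  shows "(\<Sum>x\<in>nodes N. weight N x * coord_mon p q r s (node x)) = haar_moment p q r s"
proof -
  let ?R = "{z::complex. z ^ N = 1}"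
  have minus_power: "(- (x * y)) ^ k = (-1) ^ k * (x ^ k * y ^ k)" for x y :: complex and k
    by (subst power_minus) (simp add: power_mult_distrib)
  have "(\<Sum>x\<in>nodes N. weight N x * coord_mon p q r s (node x)) =
    (\<Sum>\<sigma>\<in>?R. \<Sum>\<tau>\<in>?R. \<Sum>u\<in>?R. (\<sigma> ^ p * inverse \<sigma> ^ s) * ((\<tau> ^ q * inverse \<tau> ^ r) *
      (moment_weight N u * (csqrt u ^ (p + s) * csqrt (1 - u) ^ (q + r) * (-1) ^ r) / of_nat N ^ 2)))"
    unfolding nodes_def sum.cartesian_product
    by (intro sum.cong refl)
       (auto simp: weight_def node_def coord_mon_def power_mult_distrib power_add
         minus_power)
  also have "\<dots> = (\<Sum>\<sigma>\<in>?R. \<sigma> ^ p * inverse \<sigma> ^ s) * ((\<Sum>\<tau>\<in>?R. \<tau> ^ q * inverse \<tau> ^ r) *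
      (\<Sum>u\<in>?R. moment_weight N u * (csqrt u ^ (p + s) * csqrt (1 - u) ^ (q + r) * (-1) ^ r) / of_nat N ^ 2))"
    by (simp only: sum_distrib_left[symmetric] sum_distrib_right[symmetric])
  also have "\<dots> = haar_moment p q r s"
  proof (cases "p = s \<and> q = r")
    case True
    \<comment> \<open>Only even powers of the square roots survive the torus sums, so the choice of
      branch does not matter.\<close>
    have sq: "csqrt z ^ (k + k) = z ^ k" for z k
      by (metis mult_2 power2_csqrt power_mult)
    have "(\<Sum>u\<in>?R. moment_weight N u * (u ^ p * (1 - u) ^ q * (-1) ^ q) / of_nat N ^ 2)
      = (\<Sum>u\<in>?R. moment_weight N u * (u ^ p * (1 - u) ^ q)) * ((-1) ^ q / of_nat N ^ 2)"
      by (simp add: sum_distrib_right sum_distrib_left algebra_simps)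
    also have "\<dots> = fact p * fact q / fact (p + q + 1) * ((-1) ^ q / of_nat N ^ 2)"
      using assms by (subst sum_moment_weight_beta) auto
    finally show ?thesis
      using True assms by (simp add: sum_roots_unity_powers haar_moment_def sq power2_eq_square del: of_nat_Suc)
  next
    case False
    thus ?thesis using assms by (auto simp: sum_roots_unity_powers haar_moment_def)
  qed
  finally show ?thesis .
qed

definition average :: "nat \<Rightarrow> (complex mat2 \<Rightarrow> mpoly) \<Rightarrow> mpoly" where
  "average N f = (\<Sum>x\<in>nodes N. Const (weight N x) * f (node x))"

lemma average_add: "average N (\<lambda>g. f g + f' g) = average N f + average N f'"
  and average_diff: "average N (\<lambda>g. f g - f' g) = average N f - average N f'"
  and average_mult_left: "average N (\<lambda>g. c * f g) = c * average N f"
  and average_mult_right: "average N (\<lambda>g. f g * c) = average N f * c"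
  and average_0: "average N (\<lambda>g. 0) = 0"
  by (simp_all add: average_def sum.distrib sum_subtractf sum_distrib_left sum_distrib_right algebra_simps)

lemma average_coord_mon:
  "p + q + r + s < N \<Longrightarrow> average N (\<lambda>g. Const (coord_mon p q r s g)) = Const (haar_moment p q r s)"
  by (simp add: average_def flip: quadrature Const_mult Const_sum)

lemma average_const:
  assumes "N > 0"
  shows "average N (\<lambda>g. c) = c"
proof -
  have "average N (\<lambda>g. Const (coord_mon 0 0 0 0 g)) = 1"
    using assms by (subst average_coord_mon) (simp_all add: haar_moment_def)
  thus ?thesis using average_mult_left[of N c "\<lambda>g. 1"] by (simp add: coord_mon_def)
qed

section \<open>Integration by parts\<close>

text \<open>Truncated subtraction is harmless: where it truncates, the factor \<open>of_nat\<close>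
  of the exponent is 0. Every nonzero index is read as 1.\<close>

definition coord_mon_deriv :: "nat \<Rightarrow> nat \<Rightarrow> nat \<Rightarrow> nat \<Rightarrow> nat \<Rightarrow> nat \<Rightarrow> complex mat2 \<Rightarrow> complex" where
  "coord_mon_deriv p q r s i b g =
     (if i = 0 then if b = 0 then of_nat p * coord_mon (p - 1) q r s g
                             else of_nat q * coord_mon p (q - 1) r s g
      else if b = 0 then of_nat r * coord_mon p q (r - 1) s g
                    else of_nat s * coord_mon p q r (s - 1) g)"

text \<open>A function that is bihomogeneous of degree (k, l) in the two rows of g, paired with its formal partial
  derivatives: \<open>d i b\<close> is the derivative in the entry \<open>g i b\<close>.\<close>

inductive bihom :: "nat \<Rightarrow> nat \<Rightarrow> (complex mat2 \<Rightarrow> mpoly) \<Rightarrow> (nat \<Rightarrow> nat \<Rightarrow> complex mat2 \<Rightarrow> mpoly) \<Rightarrow> bool" where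
  mon: "bihom (p + q) (r + s) (\<lambda>g. c * Const (coord_mon p q r s g))
          (\<lambda>i b g. c * Const (coord_mon_deriv p q r s i b g))"
| add: "bihom k l f d \<Longrightarrow> bihom k l f' d' \<Longrightarrow> bihom k l (\<lambda>g. f g + f' g) (\<lambda>i b g. d i b g + d' i b g)"

lemma coord_mon_mult:
  "coord_mon (p + p') (q + q') (r + r') (s + s') g = coord_mon p q r s g * coord_mon p' q' r' s' g"
  by (simp add: coord_mon_def power_add)

lemma coord_mon_deriv_mult:
  "coord_mon_deriv (p + p') (q + q') (r + r') (s + s') i b g =
     coord_mon_deriv p q r s i b g * coord_mon p' q' r' s' g
   + coord_mon p q r s g * coord_mon_deriv p' q' r' s' i b g"
proof -
  have pow: "of_nat (m + m') * x ^ (m + m' - 1) * y =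
     of_nat m * x ^ (m - 1) * x ^ m' * y + x ^ m * (of_nat m' * x ^ (m' - 1)) * y" for m m' and x y :: complex
    by (cases m; cases m') (simp_all add: power_add algebra_simps)
  show ?thesis
  proof (cases "i = 0"; cases "b = 0")
    assume ib: "i = 0" "b = 0"
    show ?thesis using pow[of p p' "g 0 0"
        "g 0 1 ^ q * g 0 1 ^ q' * g 1 0 ^ r * g 1 0 ^ r' * g 1 1 ^ s * g 1 1 ^ s'"]
      unfolding coord_mon_deriv_def coord_mon_def power_add if_P[OF ib(1)] if_P[OF ib(2)] by (simp only: mult_ac)
  next
    assume ib: "i = 0" "b \<noteq> 0"
    show ?thesis using pow[of q q' "g 0 1"
        "g 0 0 ^ p * g 0 0 ^ p' * g 1 0 ^ r * g 1 0 ^ r' * g 1 1 ^ s * g 1 1 ^ s'"]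
      unfolding coord_mon_deriv_def coord_mon_def power_add if_P[OF ib(1)] if_not_P[OF ib(2)] by (simp only: mult_ac)
  next
    assume ib: "i \<noteq> 0" "b = 0"
    show ?thesis using pow[of r r' "g 1 0"
        "g 0 0 ^ p * g 0 0 ^ p' * g 0 1 ^ q * g 0 1 ^ q' * g 1 1 ^ s * g 1 1 ^ s'"]
      unfolding coord_mon_deriv_def coord_mon_def power_add if_not_P[OF ib(1)] if_P[OF ib(2)] by (simp only: mult_ac)
  next
    assume ib: "i \<noteq> 0" "b \<noteq> 0"
    show ?thesis using pow[of s s' "g 1 1"
        "g 0 0 ^ p * g 0 0 ^ p' * g 0 1 ^ q * g 0 1 ^ q' * g 1 0 ^ r * g 1 0 ^ r'"]
      unfolding coord_mon_deriv_def coord_mon_def power_add if_not_P[OF ib(1)] if_not_P[OF ib(2)] by (simp only: mult_ac)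
  qed
qed

lemma bihom_mult:
  assumes "bihom k l f d" "bihom k' l' f' d'"
  shows "bihom (k + k') (l + l') (\<lambda>g. f g * f' g) (\<lambda>i b g. d i b g * f' g + f g * d' i b g)"
  using assms(1)
proof (induction rule: bihom.induct)
  case (mon p q r s c)
  show ?case using assms(2)
  proof (induction rule: bihom.induct)
    case (mon p' q' r' s' c')
    show ?case
      using bihom.mon[of "p + p'" "q + q'" "r + r'" "s + s'" "c * c'"]
      by (simp add: coord_mon_mult coord_mon_deriv_mult Const_mult Const_add algebra_simps)
  next
    case (add k l f1 d1 f2 d2)
    from bihom.add[OF add.IH] show ?case by (simp add: algebra_simps)
  qed
next
  case (add k l f1 d1 f2 d2)
  from bihom.add[OF add.IH] show ?case by (simp add: algebra_simps)
qed

lemma bihom_const: "bihom 0 0 (\<lambda>g. c) (\<lambda>i b g. 0)"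
proof -
  have "coord_mon_deriv 0 0 0 0 i b g = 0" for i b g by (simp add: coord_mon_deriv_def)
  thus ?thesis using bihom.mon[of 0 0 0 0 c] by (simp add: coord_mon_def)
qed

text \<open>Integration by parts for a single monomial. If the exponent multiplying the right-hand
  side is 0, the moment on the left has unequal exponents and vanishes as well.\<close>

lemma haar_moment_rec:
  "haar_moment (Suc p) q r s = of_nat s * haar_moment p q r (s - 1) / of_nat (r + s + 1)"
  "haar_moment p (Suc q) r s = - (of_nat r * haar_moment p q (r - 1) s / of_nat (r + s + 1))"
  "haar_moment p q (Suc r) s = - (of_nat q * haar_moment p (q - 1) r s / of_nat (p + q + 1))"
  "haar_moment p q r (Suc s) = of_nat p * haar_moment (p - 1) q r s / of_nat (p + q + 1)"
  subgoal by (cases s) (auto simp: haar_moment_def field_simps simp del: of_nat_Suc)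
  subgoal by (cases r) (auto simp: haar_moment_def field_simps simp del: of_nat_Suc)
  subgoal by (cases q) (auto simp: haar_moment_def field_simps simp del: of_nat_Suc)
  subgoal by (cases p) (auto simp: haar_moment_def field_simps simp del: of_nat_Suc)
  done

lemma average_mon_mult:
  assumes "p + q + r + s + 1 < N"
  shows "average N (\<lambda>g. Const (g 0 0) * (c * Const (coord_mon p q r s g))) = c * Const (haar_moment (Suc p) q r s)"
    and "average N (\<lambda>g. Const (g 0 1) * (c * Const (coord_mon p q r s g))) = c * Const (haar_moment p (Suc q) r s)"
    and "average N (\<lambda>g. Const (g 1 0) * (c * Const (coord_mon p q r s g))) = c * Const (haar_moment p q (Suc r) s)"
    and "average N (\<lambda>g. Const (g 1 1) * (c * Const (coord_mon p q r s g))) = c * Const (haar_moment p q r (Suc s))"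
proof -
  have shift: "Const (g 0 0) * (c * Const (coord_mon p q r s g)) = c * Const (coord_mon (Suc p) q r s g)"
    "Const (g 0 1) * (c * Const (coord_mon p q r s g)) = c * Const (coord_mon p (Suc q) r s g)"
    "Const (g 1 0) * (c * Const (coord_mon p q r s g)) = c * Const (coord_mon p q (Suc r) s g)"
    "Const (g 1 1) * (c * Const (coord_mon p q r s g)) = c * Const (coord_mon p q r (Suc s) g)" for g
    by (simp_all add: coord_mon_def Const_mult algebra_simps)
  show "average N (\<lambda>g. Const (g 0 0) * (c * Const (coord_mon p q r s g))) = c * Const (haar_moment (Suc p) q r s)"
    "average N (\<lambda>g. Const (g 0 1) * (c * Const (coord_mon p q r s g))) = c * Const (haar_moment p (Suc q) r s)"
    "average N (\<lambda>g. Const (g 1 0) * (c * Const (coord_mon p q r s g))) = c * Const (haar_moment p q (Suc r) s)"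
    "average N (\<lambda>g. Const (g 1 1) * (c * Const (coord_mon p q r s g))) = c * Const (haar_moment p q r (Suc s))"
    unfolding shift by (subst average_mult_left, subst average_coord_mon, use assms in simp, simp)+
qed

lemma average_mon_deriv:
  assumes "p + q + r + s < N"
  shows "average N (\<lambda>g. c * Const (coord_mon_deriv p q r s 0 0 g)) = c * Const (of_nat p * haar_moment (p - 1) q r s)"
    and "average N (\<lambda>g. c * Const (coord_mon_deriv p q r s 0 1 g)) = c * Const (of_nat q * haar_moment p (q - 1) r s)"
    and "average N (\<lambda>g. c * Const (coord_mon_deriv p q r s 1 0 g)) = c * Const (of_nat r * haar_moment p q (r - 1) s)"
    and "average N (\<lambda>g. c * Const (coord_mon_deriv p q r s 1 1 g)) = c * Const (of_nat s * haar_moment p q r (s - 1))"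
  using assms by (simp_all add: coord_mon_deriv_def Const_mult average_mult_left average_coord_mon)

text \<open>For the Haar integral the first formula comes from the invariant vector field F = g_00
  d_10 + g_01 d_11, whose derivatives integrate to 0. Euler's relation in row 1 and det g = 1 give
  d_11 f = l g_00 f - g_10 F f = (l + 1) g_00 f - F(g_10 f). The other formulas follow in the same
  way. The quadrature has no vector fields, so the proof checks monomials through
  \<open>haar_moment_rec\<close>; the bound on N is the degree of an entry of g times f.\<close>

lemma integration_by_parts:
  assumes "bihom k l f d" "k + l + 1 < N"
  shows "average N (\<lambda>g. Const (g 0 0) * f g) = Const (1 / of_nat (l + 1)) * average N (d 1 1)"
    and "average N (\<lambda>g. Const (g 0 1) * f g) = - Const (1 / of_nat (l + 1)) * average N (d 1 0)"
    and "average N (\<lambda>g. Const (g 1 0) * f g) = - Const (1 / of_nat (k + 1)) * average N (d 0 1)"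
    and "average N (\<lambda>g. Const (g 1 1) * f g) = Const (1 / of_nat (k + 1)) * average N (d 0 0)"
proof -
  have "average N (\<lambda>g. Const (g 0 0) * f g) = Const (1 / of_nat (l + 1)) * average N (d 1 1) \<and>
    average N (\<lambda>g. Const (g 0 1) * f g) = - Const (1 / of_nat (l + 1)) * average N (d 1 0) \<and>
    average N (\<lambda>g. Const (g 1 0) * f g) = - Const (1 / of_nat (k + 1)) * average N (d 0 1) \<and>
    average N (\<lambda>g. Const (g 1 1) * f g) = Const (1 / of_nat (k + 1)) * average N (d 0 0)"
    using assms
  proof (induction rule: bihom.induct)
    case (mon p q r s c)
    hence N: "p + q + r + s + 1 < N" "p + q + r + s < N" by simp_all
    show ?case
      unfolding average_mon_mult[OF N(1)] average_mon_deriv[OF N(2)] haar_moment_rec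
      by (simp add: divide_inverse Const_mult Const_uminus mult_ac del: of_nat_Suc of_nat_add)
  next
    case (add k l f d f' d')
    thus ?case by (simp add: average_add algebra_simps)
  qed
  thus "average N (\<lambda>g. Const (g 0 0) * f g) = Const (1 / of_nat (l + 1)) * average N (d 1 1)"
    "average N (\<lambda>g. Const (g 0 1) * f g) = - Const (1 / of_nat (l + 1)) * average N (d 1 0)"
    "average N (\<lambda>g. Const (g 1 0) * f g) = - Const (1 / of_nat (k + 1)) * average N (d 0 1)"
    "average N (\<lambda>g. Const (g 1 1) * f g) = Const (1 / of_nat (k + 1)) * average N (d 0 0)"
    by blast+
qed

section \<open>Averages of products of chains\<close>

text \<open>With J = [[0, 1], [-1, 0]], a chain is row_i(g) M J row_j(g)^T, and a side is an entry of the
  column M J row_j(g)^T. Since J row_j(g)^T is, up to sign, column 1 - j of the adjugate of g, chains are up to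
  sign the entries of g M g^-1.\<close>

definition side :: "mpoly mat2 \<Rightarrow> nat \<Rightarrow> nat \<Rightarrow> complex mat2 \<Rightarrow> mpoly" where
  "side M j a g = M a 0 * Const (g j 1) - M a 1 * Const (g j 0)"

definition chain :: "nat \<Rightarrow> mpoly mat2 \<Rightarrow> nat \<Rightarrow> complex mat2 \<Rightarrow> mpoly" where
  "chain i M j g = Const (g i 0) * side M j 0 g + Const (g i 1) * side M j 1 g"

text \<open>Rows are compared through \<open>(i = 0) = (j = 0)\<close> because \<open>bihom\<close>
  requires agreement with \<open>coord_mon_deriv\<close> at all indices, and that function reads
  every nonzero index as 1.\<close>

definition side_deriv :: "mpoly mat2 \<Rightarrow> nat \<Rightarrow> nat \<Rightarrow> nat \<Rightarrow> nat \<Rightarrow> mpoly" where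
  "side_deriv M j a i b = (if (i = 0) = (j = 0) then if b = 0 then - M a 1 else M a 0 else 0)"

definition chain_deriv :: "nat \<Rightarrow> mpoly mat2 \<Rightarrow> nat \<Rightarrow> nat \<Rightarrow> nat \<Rightarrow> complex mat2 \<Rightarrow> mpoly" where
  "chain_deriv i M j i' b g =
     (if (i' = 0) = (i = 0) then side M j (if b = 0 then 0 else 1) g else 0)
     + Const (g i 0) * side_deriv M j 0 i' b + Const (g i 1) * side_deriv M j 1 i' b"

definition row_degree :: "nat \<Rightarrow> nat \<Rightarrow> nat" where
  "row_degree r i = (if i = r then 1 else 0)"

lemma bihom_coord:
  assumes "i < 2" "b < 2"
  shows "bihom (row_degree 0 i) (row_degree 1 i) (\<lambda>g. Const (g i b))
           (\<lambda>i' b' g. if (i' = 0) = (i = 0) \<and> (b' = 0) = (b = 0) then 1 else 0)"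
proof -
  have eq: "(\<lambda>i' b' g. c * Const (coord_mon_deriv p q r s i' b' g)) =
        (\<lambda>i' b' g. if (i' = 0) = (i = 0) \<and> (b' = 0) = (b = 0) then 1 else 0)"
    if "(p, q, r, s, i, b) \<in> {(1,0,0,0,0,0), (0,1,0,0,0,1), (0,0,1,0,1,0), (0,0,0,1,1,1)}" "c = 1"
    for p q r s c
    using that by (auto simp: fun_eq_iff coord_mon_deriv_def coord_mon_def)
  consider "i = 0" "b = 0" | "i = 0" "b = 1" | "i = 1" "b = 0" | "i = 1" "b = 1"
    using assms by (auto simp: less_2_cases_iff)
  thus ?thesis
  proof cases
    case 1 thus ?thesis using bihom.mon[of 1 0 0 0 1]
      by (subst eq[symmetric, of 1 0 0 0 1]) (auto simp: row_degree_def coord_mon_def)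
  next
    case 2 thus ?thesis using bihom.mon[of 0 1 0 0 1]
      by (subst eq[symmetric, of 0 1 0 0 1]) (auto simp: row_degree_def coord_mon_def)
  next
    case 3 thus ?thesis using bihom.mon[of 0 0 1 0 1]
      by (subst eq[symmetric, of 0 0 1 0 1]) (auto simp: row_degree_def coord_mon_def)
  next
    case 4 thus ?thesis using bihom.mon[of 0 0 0 1 1]
      by (subst eq[symmetric, of 0 0 0 1 1]) (auto simp: row_degree_def coord_mon_def)
  qed
qed

lemma bihom_side:
  assumes "j < 2"
  shows "bihom (row_degree 0 j) (row_degree 1 j) (side M j a) (\<lambda>i b g. side_deriv M j a i b)"
proof -
  have "bihom (row_degree 0 j) (row_degree 1 j)
     (\<lambda>g. M a 0 * Const (g j 1) + (- M a 1) * Const (g j 0))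
     (\<lambda>i b g. M a 0 * (if (i = 0) = (j = 0) \<and> (b = 0) = (1 = (0::nat)) then 1 else 0)
            + (- M a 1) * (if (i = 0) = (j = 0) \<and> (b = 0) = (0 = (0::nat)) then 1 else 0))"
  proof (rule bihom.add)
    have scaled: "bihom (row_degree 0 j) (row_degree 1 j) (\<lambda>g. c * Const (g j b))
      (\<lambda>i' b' g. c * (if (i' = 0) = (j = 0) \<and> (b' = 0) = (b = 0) then 1 else 0))" if "b < 2" for c b
      using bihom_mult[OF bihom_const[of c] bihom_coord[OF assms that]]
      by (simp only: add_0 mult_zero_left)
    show "bihom (row_degree 0 j) (row_degree 1 j) (\<lambda>g. M a 0 * Const (g j 1))
      (\<lambda>i b g. M a 0 * (if (i = 0) = (j = 0) \<and> (b = 0) = (1 = (0::nat)) then 1 else 0))"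
      "bihom (row_degree 0 j) (row_degree 1 j) (\<lambda>g. (- M a 1) * Const (g j 0))
      (\<lambda>i b g. (- M a 1) * (if (i = 0) = (j = 0) \<and> (b = 0) = (0 = (0::nat)) then 1 else 0))"
      by (rule scaled; simp)+
  qed
  also have "(\<lambda>g. M a 0 * Const (g j 1) + (- M a 1) * Const (g j 0)) = side M j a"
    by (simp add: side_def fun_eq_iff)
  also have "(\<lambda>i b g. M a 0 * (if (i = 0) = (j = 0) \<and> (b = 0) = (1 = (0::nat)) then 1 else 0)
            + (- M a 1) * (if (i = 0) = (j = 0) \<and> (b = 0) = (0 = (0::nat)) then 1 else 0))
        = (\<lambda>i b g. side_deriv M j a i b)"
    by (auto simp: side_deriv_def fun_eq_iff)
  finally show ?thesis .
qed

lemma bihom_chain: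
  assumes "i < 2" "j < 2"
  shows "bihom (row_degree 0 i + row_degree 0 j) (row_degree 1 i + row_degree 1 j)
           (chain i M j) (chain_deriv i M j)"
proof -
  have "bihom (row_degree 0 i + row_degree 0 j) (row_degree 1 i + row_degree 1 j)
     (\<lambda>g. Const (g i 0) * side M j 0 g + Const (g i 1) * side M j 1 g)
     (\<lambda>i' b g. ((if (i' = 0) = (i = 0) \<and> (b = 0) = (0 = (0::nat)) then 1 else 0) * side M j 0 g
               + Const (g i 0) * side_deriv M j 0 i' b)
             + ((if (i' = 0) = (i = 0) \<and> (b = 0) = (1 = (0::nat)) then 1 else 0) * side M j 1 g
               + Const (g i 1) * side_deriv M j 1 i' b))"
    by (rule bihom.add; rule bihom_mult[OF bihom_coord bihom_side]) (use assms in auto)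
  also have "(\<lambda>g. Const (g i 0) * side M j 0 g + Const (g i 1) * side M j 1 g) = chain i M j"
    by (simp add: chain_def fun_eq_iff)
  also have "(\<lambda>i' b g. ((if (i' = 0) = (i = 0) \<and> (b = 0) = (0 = (0::nat)) then 1 else 0) * side M j 0 g
               + Const (g i 0) * side_deriv M j 0 i' b)
             + ((if (i' = 0) = (i = 0) \<and> (b = 0) = (1 = (0::nat)) then 1 else 0) * side M j 1 g
               + Const (g i 1) * side_deriv M j 1 i' b)) = chain_deriv i M j"
    by (auto simp: chain_deriv_def fun_eq_iff)
  finally show ?thesis .
qed

text \<open>The first component is the degree of the matrix in the grading introduced below.\<close>

type_synonym link = "nat \<times> nat \<times> mpoly mat2 \<times> nat"

fun chain_prod :: "link list \<Rightarrow> complex mat2 \<Rightarrow> mpoly" where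
  "chain_prod [] g = 1"
| "chain_prod ((e, i, M, j) # cs) g = chain i M j g * chain_prod cs g"

fun chain_prod_deriv :: "link list \<Rightarrow> nat \<Rightarrow> nat \<Rightarrow> complex mat2 \<Rightarrow> mpoly" where
  "chain_prod_deriv [] i' b g = 0"
| "chain_prod_deriv ((e, i, M, j) # cs) i' b g =
     chain_deriv i M j i' b g * chain_prod cs g + chain i M j g * chain_prod_deriv cs i' b g"

fun chain_degree :: "nat \<Rightarrow> link list \<Rightarrow> nat" where
  "chain_degree r [] = 0"
| "chain_degree r ((e, i, M, j) # cs) = (row_degree r i + row_degree r j) + chain_degree r cs"

lemma chain_prod_append: "chain_prod (cs @ cs') g = chain_prod cs g * chain_prod cs' g"
  by (induction cs g rule: chain_prod.induct) (simp_all add: mult.assoc)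

lemma bihom_chain_prod:
  assumes "\<forall>(e, i, M, j) \<in> set cs. i < 2 \<and> j < 2"
  shows "bihom (chain_degree 0 cs) (chain_degree 1 cs) (chain_prod cs) (chain_prod_deriv cs)"
  using assms
proof (induction cs)
  case Nil
  have "chain_prod [] = (\<lambda>g. 1)" "chain_prod_deriv [] = (\<lambda>i b g. 0)"
    by (simp_all add: fun_eq_iff)
  thus ?case using bihom_const[of 1] by simp
next
  case (Cons c cs)
  obtain e i M j where c: "c = (e, i, M, j)" by (cases c)
  have "bihom (row_degree 0 i + row_degree 0 j + chain_degree 0 cs)
    (row_degree 1 i + row_degree 1 j + chain_degree 1 cs) (\<lambda>g. chain i M j g * chain_prod cs g)
    (\<lambda>i' b g. chain_deriv i M j i' b g * chain_prod cs g + chain i M j g * chain_prod_deriv cs i' b g)"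
    using Cons by (intro bihom_mult bihom_chain) (auto simp: c)
  moreover have "(\<lambda>g. chain i M j g * chain_prod cs g) = chain_prod (c # cs)"
    "(\<lambda>i' b g. chain_deriv i M j i' b g * chain_prod cs g + chain i M j g * chain_prod_deriv cs i' b g)
      = chain_prod_deriv (c # cs)" by (simp_all add: c fun_eq_iff)
  ultimately show ?case by (simp add: c)
qed

lemma row_degree_le: "i < 2 \<Longrightarrow> row_degree 0 i + row_degree 1 i = 1"
  by (auto simp: row_degree_def less_2_cases_iff)

lemma chain_degree_le:
  "\<forall>(e, i, M, j) \<in> set cs. i < 2 \<and> j < 2 \<Longrightarrow> chain_degree 0 cs + chain_degree 1 cs = 2 * length cs"
proof (induction cs)
  case (Cons c cs)
  obtain e i M j where c: "c = (e, i, M, j)" by (cases c)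
  show ?case using Cons row_degree_le[of i] row_degree_le[of j] by (simp add: c)
qed simp

text \<open>Integration by parts in the left end of a chain (i, M, j) joins this end to all ends of type 1 - i of
  the other factors. Joining the ends of two chains multiplies their matrices (after reversing one of
  them by the adjugate, if necessary), closing up a single chain produces a trace.\<close>

definition contract :: "nat \<Rightarrow> mpoly mat2 \<Rightarrow> nat \<Rightarrow> (nat \<Rightarrow> nat \<Rightarrow> complex mat2 \<Rightarrow> mpoly) \<Rightarrow> complex mat2 \<Rightarrow> mpoly" where
  "contract i M j d g = side M j 0 g * d (1 - i) 1 g - side M j 1 g * d (1 - i) 0 g"

text \<open>Integrating by parts in the entries of row i at the left end differentiates the rest in
  row 1 - i. The derivative hits either the other chains, which gives \<open>contract\<close>, or
  the chain's own right end, which is possible only for j = 1 - i and closes the chain to a trace.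
  The scalar c is left unspecified because the target sets are closed under scaling.\<close>

lemma average_chain_Cons:
  assumes ij: "i < 2" "j < 2" and cs: "\<forall>(e, i, M, j) \<in> set cs. i < 2 \<and> j < 2"
    and N: "2 * length cs + 2 < N"
  shows "\<exists>c. average N (chain_prod ((e, i, M, j) # cs)) = Const c *
     (average N (contract i M j (chain_prod_deriv cs))
      + (if i = j then 0 else tr2 M * average N (chain_prod cs)))"
proof -
  define k l where "k = row_degree 0 j + chain_degree 0 cs" and "l = row_degree 1 j + chain_degree 1 cs"
  define f where "f a g = side M j a g * chain_prod cs g" for a g
  define d where "d a = (\<lambda>i' b g. side_deriv M j a i' b * chain_prod cs g + side M j a g * chain_prod_deriv cs i' b g)" for a
  have bi: "bihom k l (f a) (d a)" for a
    unfolding k_def l_def f_def d_def by (rule bihom_mult[OF bihom_side bihom_chain_prod]) (use ij cs in auto)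
  have kl: "k + l + 1 < N"
    using row_degree_le[OF ij(2)] chain_degree_le[OF cs] N by (simp add: k_def l_def)
  note parts = integration_by_parts[OF bi kl]
  have split: "average N (chain_prod ((e, i, M, j) # cs)) =
    average N (\<lambda>g. Const (g i 0) * f 0 g) + average N (\<lambda>g. Const (g i 1) * f 1 g)"
    unfolding average_add[symmetric]
    by (rule arg_cong[of _ _ "average N"]) (simp add: fun_eq_iff chain_def f_def algebra_simps)
  \<comment> \<open>When j = 1 - i, the derivatives of the two sides contribute M 0 0 and, after the
    subtraction, M 1 1, hence the trace.\<close>
  have dd: "average N (d 0 (1 - i) 1) - average N (d 1 (1 - i) 0) =
     average N (contract i M j (chain_prod_deriv cs))
      + (if i = j then 0 else tr2 M * average N (chain_prod cs))"
    unfolding average_mult_left[symmetric] average_diff[symmetric]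
    using ij
    by (auto simp: less_2_cases_iff contract_def[abs_def] d_def side_deriv_def tr2_def algebra_simps
        average_add average_diff average_mult_left average_mult_right)
  have "\<exists>c. average N (chain_prod ((e, i, M, j) # cs)) =
     Const c * (average N (d 0 (1 - i) 1) - average N (d 1 (1 - i) 0))"
  proof (cases "i = 0")
    case True
    show ?thesis unfolding split using True
      by (intro exI[of _ "1 / of_nat (l + 1)"]) (simp only: parts, simp add: algebra_simps)
  next
    case False
    hence "i = 1" using ij by simp
    show ?thesis unfolding split using \<open>i = 1\<close>
      by (intro exI[of _ "- 1 / of_nat (k + 1)"]) (simp only: parts, simp add: algebra_simps Const_uminus)
  qed
  thus ?thesis unfolding dd .
qed

text \<open>The first term joins at the right end j'. For the left end i' the chain is reversed
  first: transposition, J^T = -J and J M^T J^-1 = adj M turn the chain (i', M', j') into minus the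
  chain (j', adj M', i'), which explains the sign.\<close>

lemma contract_chain:
  assumes "i < 2" "i' < 2" "j' < 2"
  shows "contract i M j (chain_deriv i' M' j') g =
     (if j' = i then 0 else chain i' (mmul M' M) j g) - (if i' = i then 0 else chain j' (mmul (adj2 M') M) j g)"
proof -
  have "i = 0 \<or> i = 1" "i' = 0 \<or> i' = 1" "j' = 0 \<or> j' = 1"
    using assms by auto
  thus ?thesis
    unfolding contract_def chain_deriv_def side_deriv_def chain_def side_def mmul_def
    by (elim disjE; simp only: adj2_simps if_True if_False simp_thms zero_neq_one one_neq_zero
          diff_zero diff_self_eq_0; simp add: algebra_simps)
qed

text \<open>Degree 0 is the invariant theory of the generic matrices, degree 1 collects what contains
  exactly one relator factor; higher degrees will be unrestricted.\<close>

locale trace_grading =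
  fixes Ms :: "nat \<Rightarrow> mpoly mat2 set" and Ts :: "nat \<Rightarrow> mpoly set"
  assumes Ts_one: "1 \<in> Ts 0" and Ts_zero: "0 \<in> Ts e"
    and Ts_add: "x \<in> Ts e \<Longrightarrow> y \<in> Ts e \<Longrightarrow> x + y \<in> Ts e"
    and Ts_scale: "x \<in> Ts e \<Longrightarrow> Const c * x \<in> Ts e"
    and Ts_mult: "x \<in> Ts d \<Longrightarrow> y \<in> Ts e \<Longrightarrow> x * y \<in> Ts (d + e)"
    and Ms_mmul: "A \<in> Ms d \<Longrightarrow> B \<in> Ms e \<Longrightarrow> mmul A B \<in> Ms (d + e)"
    and Ms_adj2: "A \<in> Ms e \<Longrightarrow> adj2 A \<in> Ms e"
    and Ts_tr2: "A \<in> Ms e \<Longrightarrow> tr2 A \<in> Ts e"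
begin

lemma Ts_diff: "x \<in> Ts e \<Longrightarrow> y \<in> Ts e \<Longrightarrow> x - y \<in> Ts e"
  using Ts_add[OF _ Ts_scale[of y e "-1"], of x] by (simp add: Const_uminus)

definition links :: "link set" where
  "links = {(e, i, M, j). M \<in> Ms e \<and> i < 2 \<and> j < 2}"

text \<open>The product rule, with \<open>pre\<close> holding the factors already passed over
  undifferentiated. Joining absorbs M into a single factor, so every term is again a product of m
  chains with the same total degree. The first assumption is the induction hypothesis of
  \<open>average_chain_prod\<close>.\<close>

lemma average_contract:
  assumes "\<And>cs. set cs \<subseteq> links \<Longrightarrow> length cs = m \<Longrightarrow> average N (chain_prod cs) \<in> Ts (sum_list (map fst cs))"
    and "M \<in> Ms e" "i < 2" "j < 2"
    and "set pre \<subseteq> links" "set cs \<subseteq> links" "length pre + length cs = m"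
  shows "average N (\<lambda>g. chain_prod pre g * contract i M j (chain_prod_deriv cs) g)
           \<in> Ts (e + sum_list (map fst pre) + sum_list (map fst cs))"
  using assms(5-)
proof (induction cs arbitrary: pre)
  case Nil
  thus ?case by (simp add: contract_def average_0 Ts_zero)
next
  case (Cons c cs)
  obtain e' i' M' j' where c: "c = (e', i', M', j')" by (cases c)
  have c': "M' \<in> Ms e'" "i' < 2" "j' < 2" using Cons.prems by (auto simp: c links_def)
  let ?e = "e + sum_list (map fst pre) + sum_list (map fst (c # cs))"
  define A B where "A = average N (\<lambda>g. chain_prod pre g * chain i' (mmul M' M) j g * chain_prod cs g)"
    and "B = average N (\<lambda>g. chain_prod pre g * chain j' (mmul (adj2 M') M) j g * chain_prod cs g)"
  have replaced: "average N (\<lambda>g. chain_prod pre g * chain k M'' j g * chain_prod cs g) \<in> Ts ?e"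
    if "M'' \<in> Ms (e' + e)" "k < 2" for k M''
  proof -
    have "average N (chain_prod (pre @ (e' + e, k, M'', j) # cs))
        \<in> Ts (sum_list (map fst (pre @ (e' + e, k, M'', j) # cs)))"
      by (rule assms(1)) (use Cons.prems that assms(4) in \<open>auto simp: links_def\<close>)
    moreover have "chain_prod (pre @ (e' + e, k, M'', j) # cs)
      = (\<lambda>g. chain_prod pre g * chain k M'' j g * chain_prod cs g)"
      by (simp add: fun_eq_iff chain_prod_append mult.assoc)
    moreover have "sum_list (map fst (pre @ (e' + e, k, M'', j) # cs)) = ?e" by (simp add: c)
    ultimately show ?thesis by (simp only:)
  qed
  have AB: "A \<in> Ts ?e" "B \<in> Ts ?e"
    unfolding A_def B_def
    by (rule replaced[OF Ms_mmul[OF c'(1) assms(2)] c'(2)],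
        rule replaced[OF Ms_mmul[OF Ms_adj2[OF c'(1)] assms(2)] c'(3)])
  have IH: "average N (\<lambda>g. chain_prod (pre @ [c]) g * contract i M j (chain_prod_deriv cs) g) \<in> Ts ?e"
    using Cons.IH[of "pre @ [c]"] Cons.prems by (simp add: add_ac)
  have "(\<lambda>g. chain_prod pre g * contract i M j (chain_prod_deriv (c # cs)) g) =
    (\<lambda>g. chain_prod pre g * contract i M j (chain_deriv i' M' j') g * chain_prod cs g
       + chain_prod (pre @ [c]) g * contract i M j (chain_prod_deriv cs) g)"
    by (simp add: c fun_eq_iff contract_def chain_prod_append algebra_simps)
  also have "\<dots> = (\<lambda>g. (if j' = i then 0 else chain_prod pre g * chain i' (mmul M' M) j g * chain_prod cs g)
      - (if i' = i then 0 else chain_prod pre g * chain j' (mmul (adj2 M') M) j g * chain_prod cs g)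
      + chain_prod (pre @ [c]) g * contract i M j (chain_prod_deriv cs) g)"
    unfolding contract_chain[OF assms(3) c'(2,3)] by (auto simp: algebra_simps)
  finally have expand: "(\<lambda>g. chain_prod pre g * contract i M j (chain_prod_deriv (c # cs)) g) = \<dots>" .
  have "average N (\<lambda>g. chain_prod pre g * contract i M j (chain_prod_deriv (c # cs)) g) =
    ((if j' = i then 0 else A) - (if i' = i then 0 else B)) +
    average N (\<lambda>g. chain_prod (pre @ [c]) g * contract i M j (chain_prod_deriv cs) g)"
    unfolding expand by (simp add: average_add average_diff average_0 A_def B_def)
  moreover have "\<dots> \<in> Ts ?e" using AB IH by (auto intro!: Ts_add Ts_diff Ts_zero)
  ultimately show ?case by (simp only:)
qed

text \<open>Induction on the number of chains: joining one chain to another, or closing it to a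
  trace, leaves one chain fewer and preserves the total degree.\<close>

lemma average_chain_prod:
  assumes "set cs \<subseteq> links" "2 * length cs < N"
  shows "average N (chain_prod cs) \<in> Ts (sum_list (map fst cs))"
  using assms
proof (induction "length cs" arbitrary: cs)
  case 0
  hence "chain_prod cs = (\<lambda>g. 1)" "cs = []" by (auto simp: fun_eq_iff)
  thus ?case using 0 by (simp add: average_const Ts_one)
next
  case (Suc m)
  then obtain c cs' where cs: "cs = c # cs'" by (cases cs) auto
  obtain e i M j where c: "c = (e, i, M, j)" by (cases c)
  have c': "M \<in> Ms e" "i < 2" "j < 2" "set cs' \<subseteq> links" using Suc.prems by (auto simp: cs c links_def)
  have IH: "average N (chain_prod ds) \<in> Ts (sum_list (map fst ds))" if "set ds \<subseteq> links" "length ds = m" for ds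
    using Suc that by simp
  have "average N (\<lambda>g. chain_prod [] g * contract i M j (chain_prod_deriv cs') g)
           \<in> Ts (e + sum_list (map fst ([] :: link list)) + sum_list (map fst cs'))"
    by (rule average_contract[where m = m], rule IH) (use c' Suc.hyps in \<open>auto simp: cs\<close>)
  hence "average N (contract i M j (chain_prod_deriv cs')) \<in> Ts (e + sum_list (map fst cs'))"
    by simp
  moreover have "tr2 M * average N (chain_prod cs') \<in> Ts (e + sum_list (map fst cs'))"
    using c' Suc.hyps by (intro Ts_mult Ts_tr2 IH) (auto simp: cs)
  moreover obtain a where "average N (chain_prod ((e, i, M, j) # cs')) = Const a *
     (average N (contract i M j (chain_prod_deriv cs'))
      + (if i = j then 0 else tr2 M * average N (chain_prod cs')))"
    using average_chain_Cons[of i j cs' N e M] c' Suc.prems by (auto simp: cs links_def)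
  ultimately show ?case by (auto simp: cs c intro!: Ts_scale Ts_add Ts_zero)
qed

end

section \<open>Closure properties of polynomial ideals\<close>

lemma lin_comb_sum:
  assumes "\<And>x. x \<in> A \<Longrightarrow> f x \<in> lin_comb P S" "P 0" "\<And>x y. P x \<Longrightarrow> P y \<Longrightarrow> P (x + y)"
  shows "sum f A \<in> lin_comb P S"
  using assms(1) by (induction A rule: infinite_finite_induct) (simp_all add: lin_comb_add assms(2,3))

lemma gen_ideal_0: "0 \<in> gen_ideal n S"
  and gen_ideal_add: "p \<in> gen_ideal n S \<Longrightarrow> q \<in> gen_ideal n S \<Longrightarrow> p + q \<in> gen_ideal n S"
  and gen_ideal_mult: "valid_poly n a \<Longrightarrow> p \<in> gen_ideal n S \<Longrightarrow> a * p \<in> gen_ideal n S"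
  and gen_ideal_sum: "(\<And>x. x \<in> A \<Longrightarrow> f x \<in> gen_ideal n S) \<Longrightarrow> sum f A \<in> gen_ideal n S"
  and gen_ideal_base: "s \<in> S \<Longrightarrow> s \<in> gen_ideal n S"
  unfolding gen_ideal_eq_lin_comb
  by (auto intro: lin_comb_add lin_comb_mult lin_comb_sum lin_comb_base valid_poly_add valid_poly_mult)

lemma gen_ideal_uminus: "p \<in> gen_ideal n S \<Longrightarrow> - p \<in> gen_ideal n S"
  using gen_ideal_mult[OF valid_poly_Const[of n "-1"], of p S] by (simp add: Const_uminus)

lemma I_free_subset_I_pres: "I_free n \<subseteq> I_pres n L r"
  unfolding I_free_def I_pres_def gen_ideal_eq_lin_comb by (intro lin_comb_mono) blast

section \<open>The Reynolds operator\<close>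

definition reynolds :: "nat \<Rightarrow> nat \<Rightarrow> mpoly \<Rightarrow> mpoly" where
  "reynolds n N p = average N (\<lambda>g. conj_act n g p)"

lemma reynolds_sum: "reynolds n N (sum f A) = (\<Sum>x\<in>A. reynolds n N (f x))"
  by (induction A rule: infinite_finite_induct)
     (simp_all add: reynolds_def average_0 conj_act_add average_add)

lemma valid_poly_reynolds: "valid_poly n p \<Longrightarrow> valid_poly n (reynolds n N p)"
  unfolding reynolds_def average_def
  by (intro valid_poly_sum valid_poly_mult valid_poly_Const valid_poly_conj_act)

lemma reynolds_diff_mem:
  assumes "invariant_mod n (gen_ideal n S) p" "N > 0"
  shows "reynolds n N p - p \<in> gen_ideal n S"
proof -
  have "reynolds n N p - p = average N (\<lambda>g. conj_act n g p - p)"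
    by (simp add: reynolds_def average_diff average_const[OF assms(2)])
  also have "\<dots> \<in> gen_ideal n S"
    unfolding average_def using assms(1) det2_node[OF assms(2)]
    by (intro gen_ideal_sum gen_ideal_mult valid_poly_Const) (auto simp: invariant_mod_def)
  finally show ?thesis .
qed

lemma reynolds_mult_invariant:
  assumes "N > 0" "\<And>g. det2 g = 1 \<Longrightarrow> conj_act n g s = s"
  shows "reynolds n N (p * s) = reynolds n N p * s"
  unfolding reynolds_def average_def sum_distrib_right
  by (rule sum.cong) (simp_all add: conj_act_mult assms(2) det2_node[OF assms(1)] mult.assoc)

text \<open>Column j of the adjugate of g is J row_(1-j)(g)^T up to a sign, + for j = 0 and - for j
  = 1. The sign is absorbed into the matrix, which is why \<open>Ms_scale\<close> is assumed
  below.\<close>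

definition conj_link :: "nat \<Rightarrow> mpoly mat2 \<Rightarrow> nat \<Rightarrow> nat \<Rightarrow> link" where
  "conj_link e A i j = (e, i, \<lambda>a b. Const (if j = 0 then 1 else -1) * A a b, 1 - j)"

lemma chain_prod_conj_link:
  assumes "j < 2"
  shows "chain_prod (conj_link e A i j # cs) g = conj2 (Const_mat g) A i j * chain_prod cs g"
  using assms
  by (auto simp: less_2_cases_iff conj_link_def chain_def side_def conj2_def mmul_def Const_uminus algebra_simps)

locale conj_grading = trace_grading +
  fixes n :: nat
  assumes Ms_Xmat: "k < n \<Longrightarrow> Xmat k \<in> Ms 0"
    and Ms_scale: "A \<in> Ms e \<Longrightarrow> (\<lambda>a b. Const c * A a b) \<in> Ms e"
begin

lemma conj_link_in_links: "A \<in> Ms e \<Longrightarrow> i < 2 \<Longrightarrow> j < 2 \<Longrightarrow> conj_link e A i j \<in> links"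
  by (auto simp: conj_link_def links_def Ms_scale)

text \<open>Each variable of a monomial becomes a link of degree 0, so multiplying by p leaves the
  degree of the chains unchanged; only the threshold for N depends on p.\<close>

lemma eventually_average_conj_act:
  assumes "valid_poly n p" "set cs \<subseteq> links"
  shows "eventually (\<lambda>N. average N (\<lambda>g. conj_act n g p * chain_prod cs g) \<in> Ts (sum_list (map fst cs))) sequentially"
  using assms(1)
proof (induction rule: valid_poly_induct)
  case (monomial c xs)
  define ds where "ds = map (\<lambda>(k, i, j). conj_link 0 (Xmat k) i j) xs"
  have "map fst ds = map (\<lambda>_. 0) xs"
    by (auto simp: ds_def conj_link_def)
  hence ds: "set ds \<subseteq> links" "sum_list (map fst ds) = 0"
    using monomial by (auto simp: ds_def vars_def intro!: conj_link_in_links Ms_Xmat)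
  have prod: "chain_prod (ds @ cs) g = conj_act n g (prod_list (map Var xs)) * chain_prod cs g" for g
    using monomial unfolding ds_def
  proof (induction xs)
    case (Cons x xs)
    obtain k i j where x: "x = (k, i, j)" by (cases x)
    have j: "j < 2" and kij: "(k, i, j) \<in> vars n" using Cons.prems by (auto simp: x vars_def)
    have IH: "chain_prod (map (\<lambda>(k, i, j). conj_link 0 (Xmat k) i j) xs @ cs) g
       = conj_act n g (prod_list (map Var xs)) * chain_prod cs g"
      using Cons by simp
    show ?case
      by (simp add: x chain_prod_conj_link[OF j] IH conj_act_mult conj_act_Var[OF kij] mult.assoc)
  qed simp
  have "average N (\<lambda>g. conj_act n g (Const c * prod_list (map Var xs)) * chain_prod cs g)
     \<in> Ts (sum_list (map fst cs))" if N: "N > 2 * length (ds @ cs)" for N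
  proof -
    have "average N (chain_prod (ds @ cs)) \<in> Ts (sum_list (map fst (ds @ cs)))"
      by (rule average_chain_prod) (use ds assms(2) N in auto)
    hence "Const c * average N (chain_prod (ds @ cs)) \<in> Ts (sum_list (map fst cs))"
      using ds by (auto intro: Ts_scale)
    also have "Const c * average N (chain_prod (ds @ cs)) =
      average N (\<lambda>g. conj_act n g (Const c * prod_list (map Var xs)) * chain_prod cs g)"
      unfolding average_mult_left[symmetric] prod by (simp add: conj_act_mult mult.assoc)
    finally show ?thesis .
  qed
  thus ?case by (auto simp: eventually_sequentially intro: exI[of _ "Suc (2 * length (ds @ cs))"])
next
  case (add p q)
  from add.IH show ?case
    by eventually_elim (simp add: conj_act_add distrib_right average_add Ts_add)
qed

lemma eventually_reynolds:
  assumes "valid_poly n p"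
  shows "eventually (\<lambda>N. reynolds n N p \<in> Ts 0) sequentially"
  using eventually_average_conj_act[OF assms, of "[]"] by (simp add: reynolds_def)

lemma eventually_reynolds_mult:
  assumes "valid_poly n p" "A \<in> Ms e" "i < 2" "j < 2"
    and "\<And>g. det2 g = 1 \<Longrightarrow> conj_act n g (A i j) = conj2 (Const_mat g) A i j"
  shows "eventually (\<lambda>N. reynolds n N (p * A i j) \<in> Ts e) sequentially"
proof -
  have "eventually (\<lambda>N. average N (\<lambda>g. conj_act n g p * chain_prod [conj_link e A i j] g) \<in> Ts e) sequentially"
    using eventually_average_conj_act[OF assms(1), of "[conj_link e A i j]"]
      conj_link_in_links[OF assms(2-4)] by (simp add: conj_link_def)
  moreover have "eventually (\<lambda>N::nat. N > 0) sequentially" by (rule eventually_gt_at_top)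
  ultimately show ?thesis
  proof eventually_elim
    case (elim N)
    have "reynolds n N (p * A i j) = average N (\<lambda>g. conj_act n g p * chain_prod [conj_link e A i j] g)"
      unfolding reynolds_def average_def
      by (rule sum.cong) (simp_all add: chain_prod_conj_link[OF assms(4)] conj_act_mult assms(5) det2_node[OF elim(2)])
    thus ?case using elim by simp
  qed
qed

end

section \<open>The kernel\<close>

text \<open>Polynomials whose class modulo the determinant relations lies in the ideal that the
  kernel generators span over the invariants. Its members need not be invariant, and it is a module
  over the invariants, shown closed only under multiplication by these.\<close>

definition kernel_ideal :: "nat \<Rightarrow> 'l set \<Rightarrow> ('l \<Rightarrow> word) \<Rightarrow> mpoly set" where
  "kernel_ideal n L r = {x. \<exists>y\<in>lin_comb (invariant n) (kernel_gens n L r). x - y \<in> I_free n}"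

lemma lin_comb_invariant_mult:
  "invariant n a \<Longrightarrow> p \<in> lin_comb (invariant n) S \<Longrightarrow> a * p \<in> lin_comb (invariant n) S"
  by (rule lin_comb_mult) (auto intro: invariant_mult)

lemma kernel_ideal_add:
  assumes "x \<in> kernel_ideal n L r" "y \<in> kernel_ideal n L r"
  shows "x + y \<in> kernel_ideal n L r"
proof -
  obtain x' y' where "x' \<in> lin_comb (invariant n) (kernel_gens n L r)" "x - x' \<in> I_free n"
    "y' \<in> lin_comb (invariant n) (kernel_gens n L r)" "y - y' \<in> I_free n"
    using assms by (auto simp: kernel_ideal_def)
  moreover from this have "(x - x') + (y - y') \<in> I_free n"
    unfolding I_free_def by (intro gen_ideal_add)
  ultimately show ?thesis
    unfolding kernel_ideal_def
    by (auto intro!: bexI[of _ "x' + y'"] lin_comb_add invariant_add simp: algebra_simps)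
qed

lemma kernel_ideal_mult:
  assumes "invariant n a" "x \<in> kernel_ideal n L r"
  shows "a * x \<in> kernel_ideal n L r"
proof -
  obtain x' where "x' \<in> lin_comb (invariant n) (kernel_gens n L r)" "x - x' \<in> I_free n"
    using assms by (auto simp: kernel_ideal_def)
  moreover from this have "a * (x - x') \<in> I_free n"
    unfolding I_free_def using assms(1) by (intro gen_ideal_mult) (auto simp: invariant_def)
  ultimately show ?thesis
    unfolding kernel_ideal_def
    by (auto intro!: bexI[of _ "a * x'"] lin_comb_invariant_mult assms(1) simp: algebra_simps)
qed

lemma kernel_ideal_mult_right: "x \<in> kernel_ideal n L r \<Longrightarrow> invariant n a \<Longrightarrow> x * a \<in> kernel_ideal n L r"
  using kernel_ideal_mult[of n a x] by (simp add: mult.commute)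

lemma kernel_ideal_base: "s \<in> kernel_gens n L r \<Longrightarrow> s \<in> kernel_ideal n L r"
  unfolding kernel_ideal_def I_free_def by (auto intro!: bexI[of _ s] lin_comb_base gen_ideal_0)

lemma I_free_subset_kernel_ideal: "I_free n \<subseteq> kernel_ideal n L r"
  unfolding kernel_ideal_def by (auto intro!: bexI[of _ 0])

lemma kernel_ideal_0: "0 \<in> kernel_ideal n L r"
  using I_free_subset_kernel_ideal gen_ideal_0 unfolding I_free_def by blast

abbreviation relator_mat :: "word \<Rightarrow> mpoly mat2" where
  "relator_mat w \<equiv> \<lambda>i j. weval Xmat w i j - mid i j"

text \<open>Membership is tested through the trace pairing with the whole span. This makes the set
  stable under multiplication by the span on both sides, by cyclicity of the trace.\<close>

definition kernel_mats :: "nat \<Rightarrow> 'l set \<Rightarrow> ('l \<Rightarrow> word) \<Rightarrow> mpoly mat2 set" where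
  "kernel_mats n L r = {Z. \<forall>A\<in>std_span n. tr2 (mmul A Z) \<in> kernel_ideal n L r}"

text \<open>The three generating rules of \<open>std_span\<close> correspond to the three families
  of kernel generators. The other rules are linear over the invariants, or ignore irrelevant
  indices.\<close>

lemma relator_mat_in_kernel_mats:
  assumes "l \<in> L"
  shows "relator_mat (r l) \<in> kernel_mats n L r"
  unfolding kernel_mats_def mem_Collect_eq
proof
  fix A assume "A \<in> std_span n"
  thus "tr2 (mmul A (relator_mat (r l))) \<in> kernel_ideal n L r"
  proof (induction rule: std_span.induct)
    case one
    have "trpoly (r l) - 2 \<in> kernel_gens n L r" using assms by (auto simp: kernel_gens_def)
    moreover have "trpoly (r l) - 2 = tr2 (mmul mid (relator_mat (r l)))"
      by (simp add: trpoly_def tr2_def mmul_def)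
    ultimately show ?case by (simp add: kernel_ideal_base)
  next
    case (gen i)
    have "trpoly ((i, False) # r l) - trpoly [(i, False)] \<in> kernel_gens n L r"
      using assms gen by (auto simp: kernel_gens_def)
    moreover have "trpoly ((i, False) # r l) - trpoly [(i, False)] = tr2 (mmul (Xmat i) (relator_mat (r l)))"
      by (simp add: trpoly_def tr2_def mmul_def algebra_simps)
    ultimately show ?case by (simp add: kernel_ideal_base)
  next
    case (pair j k)
    have "trpoly ((j, False) # (k, False) # r l) - trpoly [(j, False), (k, False)] \<in> kernel_gens n L r"
      using assms pair by (auto simp: kernel_gens_def)
    moreover have "trpoly ((j, False) # (k, False) # r l) - trpoly [(j, False), (k, False)]
        = tr2 (mmul (mmul (Xmat j) (Xmat k)) (relator_mat (r l)))"
      by (simp add: trpoly_def tr2_def mmul_def algebra_simps)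
    ultimately show ?case by (simp add: kernel_ideal_base)
  next
    case (add A B)
    from kernel_ideal_add[OF add.IH] show ?case by (simp add: tr2_def mmul_def algebra_simps)
  next
    case (scale b A)
    from kernel_ideal_mult[OF scale(1) scale.IH] show ?case by (simp add: tr2_def mmul_def algebra_simps)
  next
    case (cong A B)
    from cong.IH show ?case by (simp add: tr2_def mmul_def cong.hyps)
  qed
qed

lemma tr2_mmul_commute: "tr2 (mmul A B) = tr2 (mmul B A)"
  by (simp add: tr2_def mmul_def algebra_simps)

text \<open>The adjugate preserves the trace, reverses products and is an involution. This carries
  \<open>kernel_mats\<close> to itself when a chain is reversed.\<close>

lemma tr2_mmul_adj2: "tr2 (mmul A (adj2 B)) = tr2 (mmul (adj2 A) B)"
  by (simp add: tr2_def mmul_def algebra_simps)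

lemma kernel_mats_mmul_left: "A \<in> std_span n \<Longrightarrow> Z \<in> kernel_mats n L r \<Longrightarrow> mmul A Z \<in> kernel_mats n L r"
  by (auto simp: kernel_mats_def std_span_mmul simp flip: mmul_assoc)

lemma kernel_mats_mmul_right:
  assumes "A \<in> std_span n" "Z \<in> kernel_mats n L r"
  shows "mmul Z A \<in> kernel_mats n L r"
  unfolding kernel_mats_def mem_Collect_eq
proof
  fix B assume "B \<in> std_span n"
  hence "tr2 (mmul (mmul A B) Z) \<in> kernel_ideal n L r"
    using assms std_span_mmul by (auto simp: kernel_mats_def)
  thus "tr2 (mmul B (mmul Z A)) \<in> kernel_ideal n L r"
    by (metis tr2_mmul_commute mmul_assoc)
qed

definition graded_mats :: "nat \<Rightarrow> 'l set \<Rightarrow> ('l \<Rightarrow> word) \<Rightarrow> nat \<Rightarrow> mpoly mat2 set" where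
  "graded_mats n L r e = (if e = 0 then std_span n else if e = 1 then kernel_mats n L r else UNIV)"

definition graded_traces :: "nat \<Rightarrow> 'l set \<Rightarrow> ('l \<Rightarrow> word) \<Rightarrow> nat \<Rightarrow> mpoly set" where
  "graded_traces n L r e = (if e = 0 then {p. invariant n p} else if e = 1 then kernel_ideal n L r else UNIV)"

lemma conj_grading: "conj_grading (graded_mats n L r) (graded_traces n L r) n"
proof
  fix A B d e assume AB: "A \<in> graded_mats n L r d" "B \<in> graded_mats n L r e"
  \<comment> \<open>In total degree above 1 the target is everything, so only the first three cases
    have content.\<close>
  consider "d = 0" "e = 0" | "d = 0" "e = 1" | "d = 1" "e = 0" | "d + e > 1" by linarith
  thus "mmul A B \<in> graded_mats n L r (d + e)"
    by cases (use AB in \<open>auto simp: graded_mats_def std_span_mmul kernel_mats_mmul_left kernel_mats_mmul_right\<close>)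
next
  fix x y d e assume xy: "x \<in> graded_traces n L r d" "y \<in> graded_traces n L r e"
  consider "d = 0" "e = 0" | "d = 0" "e = 1" | "d = 1" "e = 0" | "d + e > 1" by linarith
  thus "x * y \<in> graded_traces n L r (d + e)"
    by cases (use xy in \<open>auto simp: graded_traces_def invariant_mult kernel_ideal_mult kernel_ideal_mult_right\<close>)
next
  fix A e assume "A \<in> graded_mats n L r e"
  thus "adj2 A \<in> graded_mats n L r e"
    by (auto simp: graded_mats_def std_span_adj2 kernel_mats_def tr2_mmul_adj2 split: if_splits)
next
  fix A e assume A: "A \<in> graded_mats n L r e"
  have "tr2 (mmul mid A) = tr2 A" by (simp add: tr2_def mmul_def)
  thus "tr2 A \<in> graded_traces n L r e"
    using A std_span.one[of n]
    by (force simp: graded_mats_def graded_traces_def kernel_mats_def invariant_tr2 std_span_equivariant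
        split: if_splits)
next
  fix A e c assume A: "A \<in> graded_mats n L r e"
  have "tr2 (mmul B (\<lambda>a b. Const c * A a b)) = Const c * tr2 (mmul B A)" for B
    by (simp add: tr2_def mmul_def algebra_simps)
  thus "(\<lambda>a b. Const c * A a b) \<in> graded_mats n L r e"
    using A by (auto simp: graded_mats_def kernel_mats_def std_span.scale kernel_ideal_mult split: if_splits)
qed (auto simp: graded_mats_def graded_traces_def invariant_add kernel_ideal_add kernel_ideal_0
    invariant_mult kernel_ideal_mult std_span.gen split: if_splits)

lemma conj_act_det2_Xmat:
  assumes "k < n" "det2 g = 1"
  shows "conj_act n g (det2 (Xmat k) - 1) = det2 (Xmat k) - 1"
  using invariant_det2[OF equivariant_Xmat[OF assms(1)]] assms(2)
  by (simp add: invariant_def conj_act_diff)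

text \<open>The determinant relations are invariant and factor out of the average, so their terms
  stay in \<open>I_free n\<close>. A relator term has exactly one factor of degree 1 and averages
  into \<open>kernel_ideal\<close>.\<close>

lemma eventually_reynolds_I_pres:
  assumes words: "\<forall>l\<in>L. \<forall>(k, b) \<in> set (r l). k < n" and q: "q \<in> I_pres n L r"
  shows "eventually (\<lambda>N. reynolds n N q \<in> kernel_ideal n L r) sequentially"
proof -
  interpret conj_grading "graded_mats n L r" "graded_traces n L r" n by (rule conj_grading)
  obtain F c where F: "finite F"
    "F \<subseteq> {det2 (Xmat k) - 1 | k. k < n} \<union> {relator_mat (r l) i j | l i j. l \<in> L \<and> i < 2 \<and> j < 2}"
    "\<forall>s\<in>F. valid_poly n (c s)" "q = (\<Sum>s\<in>F. c s * s)"
    using q unfolding I_pres_def gen_ideal_def by auto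
  have "eventually (\<lambda>N. reynolds n N (c s * s) \<in> kernel_ideal n L r) sequentially" if s: "s \<in> F" for s
  proof -
    from s F have valid: "valid_poly n (c s)" by blast
    from s F consider k where "k < n" "s = det2 (Xmat k) - 1"
      | l i j where "l \<in> L" "i < 2" "j < 2" "s = relator_mat (r l) i j" by blast
    thus ?thesis
    proof cases
      case 1
      have "reynolds n N (c s * s) \<in> kernel_ideal n L r" if "N > 0" for N
      proof -
        have "reynolds n N (c s * s) = reynolds n N (c s) * s"
          using that 1 conj_act_det2_Xmat by (intro reynolds_mult_invariant) auto
        moreover have "reynolds n N (c s) * s \<in> I_free n"
          unfolding I_free_def using 1 valid
          by (intro gen_ideal_mult valid_poly_reynolds gen_ideal_base) auto
        ultimately show ?thesis using I_free_subset_kernel_ideal by auto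
      qed
      thus ?thesis using eventually_gt_at_top[of 0] by (rule eventually_mono[rotated])
    next
      case 2
      have "relator_mat (r l) \<in> std_span n"
        using words 2 by (intro std_span_diff std_span_weval std_span.one) auto
      hence eq: "conj_act n g (relator_mat (r l) i j) = conj2 (Const_mat g) (relator_mat (r l)) i j"
        if "det2 g = 1" for g
        using std_span_equivariant that 2 unfolding equivariant_def by blast
      have "relator_mat (r l) \<in> graded_mats n L r 1"
        using relator_mat_in_kernel_mats[OF 2(1)] by (simp add: graded_mats_def)
      from eventually_reynolds_mult[OF valid this 2(2,3) eq] show ?thesis
        by (simp add: 2(4) graded_traces_def)
    qed
  qed
  hence "eventually (\<lambda>N. \<forall>s\<in>F. reynolds n N (c s * s) \<in> kernel_ideal n L r) sequentially"
    using F(1) by (intro eventually_ball_finite) auto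
  thus ?thesis
  proof eventually_elim
    case (elim N)
    have "(\<Sum>s\<in>G. reynolds n N (c s * s)) \<in> kernel_ideal n L r" if "finite G" "G \<subseteq> F" for G
      using that elim by induction (auto intro: kernel_ideal_0 kernel_ideal_add)
    thus ?case using F by (simp add: reynolds_sum)
  qed
qed

section \<open>The kernel generators vanish on representations\<close>

lemma tr2_relator_in_I_pres:
  assumes "valid_mat n A" "l \<in> L"
  shows "tr2 (mmul A (relator_mat (r l))) \<in> I_pres n L r"
proof -
  have "A i j * relator_mat (r l) j i \<in> I_pres n L r" if "i < 2" "j < 2" for i j
    unfolding I_pres_def using assms that
    by (intro gen_ideal_mult gen_ideal_base) (auto simp: valid_mat_def)
  hence "A 0 0 * relator_mat (r l) 0 0 \<in> I_pres n L r" "A 0 1 * relator_mat (r l) 1 0 \<in> I_pres n L r"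
    "A 1 0 * relator_mat (r l) 0 1 \<in> I_pres n L r" "A 1 1 * relator_mat (r l) 1 1 \<in> I_pres n L r"
    by (simp_all only: zero_less_numeral one_less_numeral_iff semiring_norm)
  hence "(A 0 0 * relator_mat (r l) 0 0 + A 0 1 * relator_mat (r l) 1 0)
    + (A 1 0 * relator_mat (r l) 0 1 + A 1 1 * relator_mat (r l) 1 1) \<in> I_pres n L r"
    unfolding I_pres_def by (intro gen_ideal_add)
  thus ?thesis by (simp add: tr2_def mmul_def)
qed

lemma kernel_gens_subset_I_pres: "kernel_gens n L r \<subseteq> I_pres n L r"
proof
  fix s assume "s \<in> kernel_gens n L r"
  then consider l where "l \<in> L" "s = trpoly (r l) - 2"
    | l i where "l \<in> L" "i < n" "s = trpoly ((i, False) # r l) - trpoly [(i, False)]"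
    | l j k where "l \<in> L" "j < k" "k < n" "s = trpoly ((j, False) # (k, False) # r l) - trpoly [(j, False), (k, False)]"
    unfolding kernel_gens_def by blast
  thus "s \<in> I_pres n L r"
  proof cases
    case 1
    hence "s = tr2 (mmul mid (relator_mat (r l)))" by (simp add: trpoly_def tr2_def mmul_def)
    thus ?thesis using tr2_relator_in_I_pres[OF valid_mat_mid 1(1)] by simp
  next
    case 2
    hence "s = tr2 (mmul (Xmat i) (relator_mat (r l)))"
      by (simp add: trpoly_def tr2_def mmul_def algebra_simps)
    thus ?thesis using tr2_relator_in_I_pres[OF valid_mat_Xmat 2(1)] 2 by simp
  next
    case 3
    hence "s = tr2 (mmul (mmul (Xmat j) (Xmat k)) (relator_mat (r l)))"
      by (simp add: trpoly_def tr2_def mmul_def algebra_simps)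
    thus ?thesis using tr2_relator_in_I_pres[OF valid_mat_mmul[OF valid_mat_Xmat valid_mat_Xmat] 3(1)] 3 by simp
  qed
qed

lemma invariant_mod_invariant: "invariant n p \<Longrightarrow> invariant_mod n (gen_ideal n S) p"
  by (simp add: invariant_def invariant_mod_def gen_ideal_0)

lemma eventually_sequentiallyE:
  assumes "eventually P sequentially"
  obtains N where "N > 0" "P N"
  using assms by (metis eventually_sequentially le_add1 add.commute zero_less_Suc Suc_eq_plus1)

text \<open>The algebras of invariants are handled through representatives. The first conjunct is
  surjectivity; the second identifies the kernel, with coefficients and equality taken modulo the
  determinant relations.\<close>

theorem theorem1:
  fixes n :: nat and L :: "'l set" and r :: "'l \<Rightarrow> word"
  assumes "\<forall>l\<in>L. \<forall>(k, b) \<in> set (r l). k < n"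
  shows "(\<forall>p. valid_poly n p \<and> invariant_mod n (I_pres n L r) p \<longrightarrow>
            (\<exists>q. valid_poly n q \<and> invariant_mod n (I_free n) q \<and> p - q \<in> I_pres n L r))
       \<and> (\<forall>q. valid_poly n q \<and> invariant_mod n (I_free n) q \<longrightarrow>
            (q \<in> I_pres n L r \<longleftrightarrow>
              (\<exists>F c. finite F \<and> F \<subseteq> kernel_gens n L r
                 \<and> (\<forall>s\<in>F. valid_poly n (c s) \<and> invariant_mod n (I_free n) (c s))
                 \<and> q - (\<Sum>s\<in>F. c s * s) \<in> I_free n)))"
proof (intro conjI allI impI iffI)
  fix p assume p: "valid_poly n p \<and> invariant_mod n (I_pres n L r) p"
  interpret conj_grading "graded_mats n L r" "graded_traces n L r" n by (rule conj_grading)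
  obtain N where N: "N > 0" "reynolds n N p \<in> graded_traces n L r 0"
    using eventually_reynolds[of p] p by (auto elim: eventually_sequentiallyE)
  hence inv: "invariant n (reynolds n N p)" by (simp add: graded_traces_def)
  have "- (reynolds n N p - p) \<in> I_pres n L r"
    using p N unfolding I_pres_def by (intro gen_ideal_uminus reynolds_diff_mem) auto
  thus "\<exists>q. valid_poly n q \<and> invariant_mod n (I_free n) q \<and> p - q \<in> I_pres n L r"
    using inv by (intro exI[of _ "reynolds n N p"])
      (auto simp: I_free_def invariant_mod_invariant invariant_def)
next
  fix q assume q: "valid_poly n q \<and> invariant_mod n (I_free n) q" and "q \<in> I_pres n L r"
  then obtain N where N: "N > 0" "reynolds n N q \<in> kernel_ideal n L r"
    using eventually_reynolds_I_pres[OF assms] by (auto elim: eventually_sequentiallyE)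
  then obtain F c where F: "finite F" "F \<subseteq> kernel_gens n L r" "\<forall>s\<in>F. invariant n (c s)"
    "reynolds n N q - (\<Sum>s\<in>F. c s * s) \<in> I_free n"
    unfolding kernel_ideal_def lin_comb_def by auto
  \<comment> \<open>The polynomial q is invariant only modulo \<open>I_free n\<close>, so replacing
    it by its average costs an element of that ideal.\<close>
  have "- (reynolds n N q - q) \<in> I_free n"
    using q N unfolding I_free_def by (intro gen_ideal_uminus reynolds_diff_mem) auto
  with F(4) have "- (reynolds n N q - q) + (reynolds n N q - (\<Sum>s\<in>F. c s * s)) \<in> I_free n"
    unfolding I_free_def by (intro gen_ideal_add)
  moreover have "\<forall>s\<in>F. valid_poly n (c s) \<and> invariant_mod n (I_free n) (c s)"
    using F(3) by (auto simp: I_free_def invariant_mod_invariant) (auto simp: invariant_def)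
  ultimately show "\<exists>F c. finite F \<and> F \<subseteq> kernel_gens n L r
                 \<and> (\<forall>s\<in>F. valid_poly n (c s) \<and> invariant_mod n (I_free n) (c s))
                 \<and> q - (\<Sum>s\<in>F. c s * s) \<in> I_free n"
    using F(1,2) by (intro exI[of _ F] exI[of _ c]) simp
next
  fix q assume "\<exists>F c. finite F \<and> F \<subseteq> kernel_gens n L r
                 \<and> (\<forall>s\<in>F. valid_poly n (c s) \<and> invariant_mod n (I_free n) (c s))
                 \<and> q - (\<Sum>s\<in>F. c s * s) \<in> I_free n"
  then obtain F c where F: "F \<subseteq> kernel_gens n L r" "\<forall>s\<in>F. valid_poly n (c s)"
    "q - (\<Sum>s\<in>F. c s * s) \<in> I_free n" by blast
  have "(\<Sum>s\<in>F. c s * s) \<in> I_pres n L r"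
    using F(1,2) kernel_gens_subset_I_pres[of n L r] unfolding I_pres_def
    by (intro gen_ideal_sum gen_ideal_mult) auto
  moreover have "q - (\<Sum>s\<in>F. c s * s) \<in> I_pres n L r"
    using F(3) I_free_subset_I_pres by blast
  ultimately have "(q - (\<Sum>s\<in>F. c s * s)) + (\<Sum>s\<in>F. c s * s) \<in> I_pres n L r"
    unfolding I_pres_def by (intro gen_ideal_add)
  thus "q \<in> I_pres n L r" by simp
qed

end
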